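(* Let $G$ be a finite abelian group with exponent $n_1=2^mp_1^{m_1}\cdots p_r^{m_r}$ ($p_1,\ldots,p_r$ distinct odd primes), and let $\mathcal{A}$ be its group scheme. Let $$\Delta=2^{w_0}(-1)^w\big((-1)^{(p_1-1)/2}p_1\big)^{w_1}\cdots\big((-1)^{(p_r-1)/2}p_r\big)^{w_r}$$ with $w,w_0,\ldots,w_r\in\{0,1\}$, $w_0=0$ if $m<3$ and $w=0$ if $m<2$. Let $$H_\Delta=\Big\{k\in\mathbb{Z}_{n_1}^*:\ \chi(k)^{w_0}\Big(\tfrac k4\Big)^{w}\Big(\tfrac k{p_1}\Big)^{w_1}\cdots\Big(\tfrac k{p_r}\Big)^{w_r}=1\Big\},$$ a subgroup of $\mathbb{Z}_{n_1}^*$, and define $g\sim_\Delta h$ iff $g=kh$ for some $k\in H_\Delta$. Let $C_1,C_2\subseteq G$ be disjoint with $0\notin C_1\cup C_2$, and $M=A_{C_1}-A_{C_2}$. Then: (i) all eigenvalues of $M$ lie in $\mathbb{Q}(\sqrt\Delta)$ if and only if both $C_1$ and $C_2$ are unions of equivalence classes of $\sim_\Delta$; (ii) all eigenvalues of $M$ are integer multiples of $\sqrt\Delta$ if and only if either $\Delta=1$ and $C_1,C_2$ are unions of equivalence classes of $\sim_1$, or $\Delta\ne1$, $C_1$ is a union of equivalence classes of $\sim_\Delta$, and $C_2=kC_1$ for some $k\in\mathbb{Z}_{n_1}^*\setminus H_\Delta$. Moreover, when $\Delta\neq1$ and the conditions in (ii) hold: if $\Delta<0$ then $C_2=-C_1$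 and $M=A_{C_1}-A_{C_1}^T$ is the skew-symmetric adjacency matrix of the oriented Cayley graph $X(G,C_1)$; if $\Delta>0$ then $C_1=-C_1$, $C_2=-C_2$ and $M$ is the symmetric adjacency matrix of the signed Cayley graph $X(G,C_1,C_2)$.
   Context: For a finite abelian group $(G,+)$, $A_g$ is the $(0,1)$-matrix indexed by $G$ with $(A_g)_{u,v}=1$ iff $v-u=g$; the group scheme is $\{A_g:g\in G\}$, and for $C\subseteq G$, $A_C=\sum_{g\in C}A_g$. The exponent $n_1$ is the least positive integer with $n_1g=0$ for all $g\in G$; for $k\in\mathbb{Z}_{n_1}^*$, $kg$ is well defined and $kC=\{kc:c\in C\}$. $\left(\frac kp\right)$ is the Legendre symbol; for odd $k$, $\left(\frac k4\right)=1$ if $k\equiv1\pmod 4$ and $-1$ if $k\equiv3\pmod4$; $\chi(k)=1$ if $k\equiv\pm1\pmod8$ and $\chi(k)=-1$ if $k\equiv\pm3\pmod8$ (these are well defined on $\mathbb{Z}_{n_1}^*$ whenever the corresponding exponent $w_0,w,w_k$ is allowed to be $1$). An oriented Cayley graph $X(G,C)$ with $C\cap(-C)=\emptyset$ has skew-symmetric adjacency matrix $A_C-A_C^T$; a signed Cayley graph $X(G,C(1),C(-1))$ with $C(\pm1)=-C(\pm1)$ disjoint has symmetric adjacency matrix $A_{C(1)}-A_{C(-1)}$. *)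

theory Defs
  imports "HOL-Analysis.Analysis" "HOL-Number_Theory.Number_Theory"
begin

definition gmul :: "nat \<Rightarrow> 'a::comm_monoid_add \<Rightarrow> 'a" where
  "gmul k g = (\<Sum>i<k. g)"

definition group_exponent :: "'a::{ab_group_add,finite} itself \<Rightarrow> nat" where
  "group_exponent _ = (LEAST n. 0 < n \<and> (\<forall>g::'a. gmul n g = 0))"

definition units_mod :: "nat \<Rightarrow> nat set" where
  "units_mod n = {k. k < n \<and> coprime k n}"

definition chi8 :: "int \<Rightarrow> int" where
  "chi8 k = (if k mod 8 = 1 \<or> k mod 8 = 7 then 1
             else if k mod 8 = 3 \<or> k mod 8 = 5 then -1 else 0)"

definition jac4 :: "int \<Rightarrow> int" where
  "jac4 k = (if k mod 4 = 1 then 1 else if k mod 4 = 3 then -1 else 0)"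

definition pstar :: "nat \<Rightarrow> int" where
  "pstar p = (-1) ^ ((p - 1) div 2) * int p"

(* Delta = 2^w0 (-1)^w prod_{p in S} p*, where S = set of odd primes p_i with w_i = 1 *)
definition Delta :: "nat \<Rightarrow> nat \<Rightarrow> nat set \<Rightarrow> int" where
  "Delta w0 w S = 2 ^ w0 * (-1) ^ w * (\<Prod>p\<in>S. pstar p)"

definition H_Delta :: "nat \<Rightarrow> nat \<Rightarrow> nat \<Rightarrow> nat set \<Rightarrow> nat set" where
  "H_Delta n1 w0 w S = {k \<in> units_mod n1.
     chi8 (int k) ^ w0 * jac4 (int k) ^ w * (\<Prod>p\<in>S. Legendre (int k) (int p)) = 1}"

definition equivH :: "nat set \<Rightarrow> 'a::comm_monoid_add \<Rightarrow> 'a \<Rightarrow> bool" where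
  "equivH H g h \<longleftrightarrow> (\<exists>k\<in>H. g = gmul k h)"

definition union_of_classes :: "nat set \<Rightarrow> ('a::comm_monoid_add) set \<Rightarrow> bool" where
  "union_of_classes H C \<longleftrightarrow> (\<forall>g h. equivH H g h \<longrightarrow> (g \<in> C \<longleftrightarrow> h \<in> C))"

definition A_elem :: "('a::{ab_group_add,finite}) \<Rightarrow> ((complex, 'a) vec, 'a) vec" where
  "A_elem g = (\<chi> u v. if v - u = g then 1 else 0)"

definition A_set :: "('a::{ab_group_add,finite}) set \<Rightarrow> ((complex, 'a) vec, 'a) vec" where
  "A_set C = (\<Sum>g\<in>C. A_elem g)"

definition is_eigenvalue :: "complex^'n^'n \<Rightarrow> complex \<Rightarrow> bool" where
  "is_eigenvalue M c \<longleftrightarrow> (\<exists>v. v \<noteq> 0 \<and> M *v v = c *s v)"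

definition Q_sqrt :: "int \<Rightarrow> complex set" where
  "Q_sqrt D = {of_real a + of_real b * csqrt (of_int D) | a b. a \<in> \<rat> \<and> b \<in> \<rat>}"

definition int_mult_sqrt :: "int \<Rightarrow> complex set" where
  "int_mult_sqrt D = {of_int z * csqrt (of_int D) | z. True}"

end

theory Submission
  imports Defs "HOL-Computational_Algebra.Squarefree"
begin

text \<open>
  The eigenvalues of \<open>A_set C1 - A_set C2\<close> are the character sums \<open>\<Sum>\<^sub>g f(g) \<psi>(g)\<close>, where \<open>f\<close> is
  the signed indicator function of \<open>C1\<close> and \<open>C2\<close>; they lie in \<open>\<int>[\<zeta>]\<close> for a primitive root of
  unity \<open>\<zeta>\<close> of order \<open>n\<close>, the exponent of the group. The automorphism \<open>\<zeta> \<mapsto> \<zeta>\<^sup>k\<close> maps such a sum to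
  \<open>\<Sum>\<^sub>g f(g) \<psi>(kg)\<close>, and it multiplies \<open>\<surd>\<Delta>\<close>, a product of quadratic Gauss sums, powers of \<open>\<i>\<close> and
  \<open>\<zeta>\<^sub>8 + \<zeta>\<^sub>8\<^sup>-\<^sup>1\<close>, by a sign \<open>\<epsilon>(k)\<close> whose kernel is \<open>H\<^sub>\<Delta>\<close>. An element of \<open>\<int>[\<zeta>]\<close> belongs to
  \<open>\<rat>(\<surd>\<Delta>)\<close> iff it is fixed by \<open>H\<^sub>\<Delta>\<close>, and, as \<open>\<Delta>\<close> is squarefree, to \<open>\<int>\<surd>\<Delta>\<close> iff every
  automorphism multiplies it by \<open>\<epsilon>(k)\<close>. Since characters separate functions on the group, these
  conditions on all character sums say that \<open>f(g) = f(kg)\<close> for \<open>k \<in> H\<^sub>\<Delta>\<close>, respectively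
  \<open>f(g) = \<epsilon>(k) f(kg)\<close> for all units \<open>k\<close>.
\<close>

section \<open>Roots of unity\<close>

definition root_of_unity :: "nat \<Rightarrow> complex" (\<open>\<zeta>\<close>) where
  "\<zeta> n = cis (2 * pi / real n)"

lemma zeta_power: "\<zeta> n ^ k = cis (2 * pi * real k / real n)"
  by (simp add: root_of_unity_def Complex.DeMoivre mult_ac)

lemma zeta_power_eq_1_iff:
  assumes "n > 0"
  shows "\<zeta> n ^ k = 1 \<longleftrightarrow> n dvd k"
proof -
  have zeta_power_n: "\<zeta> n ^ n = 1"
    using assms by (simp add: zeta_power)
  have "\<zeta> n ^ k = (\<zeta> n ^ n) ^ (k div n) * \<zeta> n ^ (k mod n)"
    by (simp flip: power_mult power_add)
  hence "\<zeta> n ^ k = \<zeta> n ^ (k mod n)"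
    by (simp add: zeta_power_n)
  moreover have "inj_on (\<lambda>k. \<zeta> n ^ k) {..<n}"
    using Complex.bij_betw_roots_unity[OF assms] by (simp add: bij_betw_def zeta_power)
  hence "\<zeta> n ^ (k mod n) = \<zeta> n ^ 0 \<longleftrightarrow> k mod n = 0"
    using assms by (subst inj_on_eq_iff[of _ "{..<n}"]) auto
  ultimately show ?thesis
    by (simp add: dvd_eq_mod_eq_0)
qed

lemma zeta_power_self [simp]: "n > 0 \<Longrightarrow> \<zeta> n ^ n = 1"
  by (simp add: zeta_power_eq_1_iff)

lemma zeta_power_power_self [simp]: "n > 0 \<Longrightarrow> (\<zeta> n ^ j) ^ n = 1"
  by (simp add: zeta_power_eq_1_iff flip: power_mult)

lemma root_of_unity_power_mod:
  fixes z :: "'a::monoid_mult"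
  assumes "z ^ n = 1"
  shows "z ^ (k mod n) = z ^ k"
  by (metis assms div_mult_mod_eq mult.commute mult_1 power_add power_mult power_one)

lemma zeta_power_cong:
  assumes "n > 0" "[k = l] (mod n)"
  shows "\<zeta> n ^ k = \<zeta> n ^ l"
  using assms by (metis cong_def root_of_unity_power_mod zeta_power_self)

lemma eq_zeta_powerE:
  assumes "n > 0" "z ^ n = 1"
  obtains j where "z = \<zeta> n ^ j"
proof -
  have "z \<in> (\<lambda>k. cis (2 * pi * real k / real n)) ` {..<n}"
    using Complex.bij_betw_roots_unity[OF assms(1)] assms(2) by (auto simp: bij_betw_def)
  thus ?thesis using that by (auto simp: zeta_power)
qed

lemma zeta_power_div:
  assumes "n > 0" "d dvd n"
  shows "\<zeta> n ^ (n div d) = \<zeta> d"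
  using assms by (elim dvdE) (simp add: root_of_unity_def Complex.DeMoivre)

lemma cnj_zeta:
  assumes "n > 0"
  shows "cnj (\<zeta> n) = \<zeta> n ^ (n - 1)"
proof -
  have "\<zeta> n * cnj (\<zeta> n) = 1"
    by (simp add: root_of_unity_def cis_cnj cis_mult)
  moreover have "\<zeta> n * \<zeta> n ^ (n - 1) = 1"
    using assms by (simp flip: power_Suc)
  ultimately show ?thesis
    by (metis mult.commute mult.left_commute mult_1)
qed

lemma sum_powers_root_of_unity:
  fixes z :: "'a::field"
  assumes "z ^ n = 1"
  shows "(\<Sum>j<n. z ^ j) = (if z = 1 then of_nat n else 0)"
  using assms by (simp add: geometric_sum)

section \<open>Evaluation of integer polynomials\<close>

definition ipoly :: "int poly \<Rightarrow> 'a::comm_ring_1 \<Rightarrow> 'a" where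
  "ipoly P x = poly (map_poly of_int P) x"

lemma ipoly_0 [simp]: "ipoly 0 x = 0"
  by (simp add: ipoly_def)

lemma ipoly_pCons [simp]: "ipoly (pCons a P) x = of_int a + x * ipoly P x"
  by (simp add: ipoly_def map_poly_pCons)

lemma ipoly_add [simp]: "ipoly (P + Q) x = ipoly P x + ipoly Q x"
proof (induction P arbitrary: Q)
  case (pCons a P)
  show ?case by (cases Q) (simp add: pCons.IH distrib_left)
qed simp

lemma ipoly_smult [simp]: "ipoly (Polynomial.smult c P) x = of_int c * ipoly P x"
  by (induction P) (simp_all add: algebra_simps)

lemma ipoly_mult [simp]: "ipoly (P * Q) x = ipoly P x * ipoly Q x"
  by (induction P) (simp_all add: algebra_simps)

lemma ipoly_diff [simp]: "ipoly (P - Q) x = ipoly P x - ipoly Q x"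
  using ipoly_add[of "P - Q" Q x] by (simp add: algebra_simps)

lemma ipoly_minus [simp]: "ipoly (- P) x = - ipoly P x"
  using ipoly_diff[of 0 P x] by simp

lemma ipoly_1 [simp]: "ipoly 1 x = 1"
  by (simp add: one_pCons)

lemma ipoly_of_int [simp]: "ipoly (of_int c) x = of_int c"
  by (simp add: of_int_poly)

lemma ipoly_of_nat [simp]: "ipoly (of_nat m) x = of_nat m"
  by (simp add: of_nat_poly)

lemma ipoly_monom [simp]: "ipoly (Polynomial.monom c m) x = of_int c * x ^ m"
  by (induction m) (simp_all add: monom_0 monom_Suc mult_ac)

lemma ipoly_power [simp]: "ipoly (P ^ m) x = ipoly P x ^ m"
  by (induction m) simp_all

lemma ipoly_sum [simp]: "ipoly (sum P I) x = (\<Sum>i\<in>I. ipoly (P i) x)"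
  by (induction I rule: infinite_finite_induct) simp_all

lemma ipoly_prod [simp]: "ipoly (prod P I) x = (\<Prod>i\<in>I. ipoly (P i) x)"
  by (induction I rule: infinite_finite_induct) simp_all

lemma ipoly_pcompose [simp]: "ipoly (pcompose P Q) x = ipoly P (ipoly Q x)"
  by (induction P) (simp_all add: pcompose_pCons)

lemma cnj_ipoly: "cnj (ipoly P x) = ipoly P (cnj x)"
  by (induction P) simp_all

section \<open>The Frobenius congruence\<close>

lemma prime_dvd_add_power_diff:
  fixes a b :: "'a::comm_ring_1"
  assumes prime_p: "prime p"
  shows "of_nat p dvd (a + b) ^ p - (a ^ p + b ^ p)"
proof -
  define middle where "middle = (\<Sum>i\<in>{1..<p}. of_nat (p choose i) * a ^ i * b ^ (p - i))"
  have p_pos: "p > 0"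
    using prime_p prime_gt_0_nat by blast
  have "{..p} = insert 0 (insert p {1..<p})"
    using p_pos by auto
  hence "(a + b) ^ p = (a ^ p + b ^ p) + middle"
    unfolding binomial_ring middle_def using p_pos by simp
  moreover have "of_nat p dvd of_nat (p choose i) * a ^ i * b ^ (p - i)" if "i \<in> {1..<p}" for i
    using dvd_choose_prime[of i p] prime_p that by (auto intro!: dvd_mult2 elim!: dvdE)
  hence "of_nat p dvd middle"
    unfolding middle_def by (rule dvd_sum)
  ultimately show ?thesis by simp
qed

lemma prime_dvd_power_diff_self:
  fixes c :: int
  assumes prime_p: "prime p"
  shows "int p dvd c ^ p - c"
proof (induction c rule: int_induct[where k = 0])
  case base
  show ?case using prime_gt_0_nat[OF prime_p] by (simp add: zero_power)
next
  case (step1 c)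
  have "int p dvd ((c + 1) ^ p - (c ^ p + 1 ^ p)) + (c ^ p - c)"
    using prime_dvd_add_power_diff[OF prime_p, of c 1] step1
    by (intro dvd_add[of _ _ "c ^ p - c"]) simp_all
  thus ?case by (simp add: algebra_simps)
next
  case (step2 c)
  have "int p dvd (c ^ p - c) - ((c - 1 + 1) ^ p - ((c - 1) ^ p + 1 ^ p))"
    using prime_dvd_add_power_diff[OF prime_p, of "c - 1" 1] step2
    by (intro dvd_diff[of _ "c ^ p - c"]) simp_all
  thus ?case by (simp add: algebra_simps)
qed

lemma prime_dvd_power_diff_pcompose:
  fixes P :: "int poly"
  assumes prime_p: "prime p"
  shows "of_nat p dvd P ^ p - pcompose P (Polynomial.monom 1 p)"
proof (induction P)
  case 0
  show ?case using prime_gt_0_nat[OF prime_p] by (simp add: zero_power)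
next
  case (pCons a P)
  define X :: "int poly" where "X = Polynomial.monom 1 1"
  have X_power: "X ^ p = Polynomial.monom 1 p"
    by (simp add: X_def monom_power)
  have pCons_eq: "pCons a P = [:a:] + X * P"
    by (simp add: X_def monom_altdef)
  have dvd_constant: "of_nat p dvd [:a:] ^ p - [:a:]"
  proof -
    obtain d where "a ^ p - a = int p * d"
      using prime_dvd_power_diff_self[OF prime_p] by blast
    hence "[:a:] ^ p - [:a:] = of_nat p * [:d:]"
      by (simp add: poly_const_pow of_nat_poly)
    thus ?thesis by (rule dvdI)
  qed
  have "pCons a P ^ p - pcompose (pCons a P) (X ^ p)
      = (([:a:] + X * P) ^ p - ([:a:] ^ p + (X * P) ^ p)) + ([:a:] ^ p - [:a:])
        + X ^ p * (P ^ p - pcompose P (X ^ p))"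
    by (simp only: pCons_eq pcompose_pCons[of a P, unfolded pCons_eq] power_mult_distrib)
       (simp add: algebra_simps)
  also have "of_nat p dvd \<dots>"
    using prime_dvd_add_power_diff[OF prime_p] dvd_constant pCons.IH
    by (intro dvd_add dvd_mult) (simp_all add: X_power)
  finally show ?case by (simp only: X_power)
qed

lemma ipoly_frobenius:
  assumes "prime p"
  obtains H where "ipoly P x ^ p = ipoly P (x ^ p) + of_nat p * ipoly H x"
proof -
  obtain H where "P ^ p - pcompose P (Polynomial.monom 1 p) = of_nat p * H"
    using prime_dvd_power_diff_pcompose[OF assms] by blast
  hence "ipoly (P ^ p - pcompose P (Polynomial.monom 1 p)) x = ipoly (of_nat p * H) x"
    by (simp only:)
  thus ?thesis using that[of H] by (simp add: diff_eq_eq add.commute)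
qed

section \<open>The ring of cyclotomic integers\<close>

definition cyclotomic_integers :: "nat \<Rightarrow> complex set" where
  "cyclotomic_integers n = range (\<lambda>P. ipoly P (\<zeta> n))"

lemma ipoly_in_cyclotomic_integers [simp]: "ipoly P (\<zeta> n) \<in> cyclotomic_integers n"
  by (simp add: cyclotomic_integers_def)

lemma cyclotomic_integersE:
  assumes "x \<in> cyclotomic_integers n"
  obtains P where "x = ipoly P (\<zeta> n)"
  using assms by (auto simp: cyclotomic_integers_def)

lemma of_int_in_cyclotomic_integers [simp]: "of_int c \<in> cyclotomic_integers n"
  by (metis ipoly_in_cyclotomic_integers ipoly_of_int)

lemma zeta_power_in_cyclotomic_integers [simp]: "\<zeta> n ^ k \<in> cyclotomic_integers n"
  using ipoly_in_cyclotomic_integers[of "Polynomial.monom 1 k" n] by simp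

lemma ipoly_zeta_power_in_cyclotomic_integers [simp]: "ipoly P (\<zeta> n ^ k) \<in> cyclotomic_integers n"
  using ipoly_in_cyclotomic_integers[of "pcompose P (Polynomial.monom 1 k)" n] by simp

lemma cyclotomic_integers_add:
  "x \<in> cyclotomic_integers n \<Longrightarrow> y \<in> cyclotomic_integers n \<Longrightarrow> x + y \<in> cyclotomic_integers n"
  by (elim cyclotomic_integersE) (simp flip: ipoly_add)

lemma cyclotomic_integers_mult:
  "x \<in> cyclotomic_integers n \<Longrightarrow> y \<in> cyclotomic_integers n \<Longrightarrow> x * y \<in> cyclotomic_integers n"
  by (elim cyclotomic_integersE) (simp flip: ipoly_mult)

lemma cyclotomic_integers_uminus:
  "x \<in> cyclotomic_integers n \<Longrightarrow> - x \<in> cyclotomic_integers n"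
  by (elim cyclotomic_integersE) (simp flip: ipoly_minus)

lemma cyclotomic_integers_power:
  "x \<in> cyclotomic_integers n \<Longrightarrow> x ^ m \<in> cyclotomic_integers n"
  by (elim cyclotomic_integersE) (simp flip: ipoly_power)

lemma cyclotomic_integers_sum:
  "(\<And>i. i \<in> I \<Longrightarrow> x i \<in> cyclotomic_integers n) \<Longrightarrow> sum x I \<in> cyclotomic_integers n"
  using of_int_in_cyclotomic_integers[of 0 n]
  by (induction I rule: infinite_finite_induct) (simp_all add: cyclotomic_integers_add)

lemma cyclotomic_integers_prod:
  "(\<And>i. i \<in> I \<Longrightarrow> x i \<in> cyclotomic_integers n) \<Longrightarrow> prod x I \<in> cyclotomic_integers n"
  using of_int_in_cyclotomic_integers[of 1 n]
  by (induction I rule: infinite_finite_induct) (simp_all add: cyclotomic_integers_mult)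

interpretation rat_complex: vector_space_pair "\<lambda>(q::rat) (z::complex). of_rat q * z" "(*)"
  by unfold_locales (simp_all add: algebra_simps of_rat_add of_rat_mult)

lemma rat_common_denominator:
  fixes A :: "rat set"
  assumes "finite A"
  obtains N :: nat where "N > 0" "\<And>q. q \<in> A \<Longrightarrow> of_nat N * q \<in> \<int>"
proof -
  define d where "d q = nat (snd (quotient_of q))" for q :: rat
  have d_pos: "d q > 0" for q
    by (simp add: d_def quotient_of_denom_pos')
  have d_clears: "of_nat (d q) * q = of_int (fst (quotient_of q))" for q
    using d_pos[of q] quotient_of_div[of q "fst (quotient_of q)" "snd (quotient_of q)"]
    by (simp add: d_def field_simps)
  have "of_nat (\<Prod>q\<in>A. d q) * q \<in> \<int>" if "q \<in> A" for q
  proof -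
    have "of_nat (\<Prod>q\<in>A. d q) * q = of_nat (\<Prod>q\<in>A - {q}. d q) * (of_nat (d q) * q)"
      using assms that by (simp add: prod.remove mult_ac)
    thus ?thesis by (simp only: d_clears Ints_mult Ints_of_nat Ints_of_int)
  qed
  moreover have "(\<Prod>q\<in>A. d q) > 0"
    using d_pos by (simp add: prod_pos)
  ultimately show ?thesis using that by blast
qed

lemma integral_multiple_of_functional_on_cyclotomic_integers:
  fixes l :: "complex \<Rightarrow> rat"
  assumes n_pos: "n > 0"
    and l_add: "\<And>y z. l (y + z) = l y + l z"
    and l_scale: "\<And>q y. l (of_rat q * y) = q * l y"
  obtains N :: nat where "N > 0" "\<And>y. y \<in> cyclotomic_integers n \<Longrightarrow> of_nat N * l y \<in> \<int>"
proof -
  obtain N :: nat where N_pos: "N > 0"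
    and N_clears: "\<And>q. q \<in> (\<lambda>j. l (\<zeta> n ^ j)) ` {..<n} \<Longrightarrow> of_nat N * q \<in> \<int>"
    using rat_common_denominator[of "(\<lambda>j. l (\<zeta> n ^ j)) ` {..<n}"] by blast
  have N_power: "of_nat N * l (\<zeta> n ^ j) \<in> \<int>" for j
  proof -
    have "of_nat N * l (\<zeta> n ^ (j mod n)) \<in> \<int>"
      using n_pos by (intro N_clears imageI) simp
    thus ?thesis
      using zeta_power_cong[OF n_pos, of "j mod n" j] by simp
  qed
  have "of_nat N * l (\<zeta> n ^ j * ipoly P (\<zeta> n)) \<in> \<int>" for P j
  proof (induction P arbitrary: j)
    case 0
    show ?case using l_scale[of 0 0] by simp
  next
    case (pCons a P)
    have "\<zeta> n ^ j * ipoly (pCons a P) (\<zeta> n)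
        = of_rat (of_int a) * \<zeta> n ^ j + \<zeta> n ^ Suc j * ipoly P (\<zeta> n)"
      by (simp add: algebra_simps)
    hence "of_nat N * l (\<zeta> n ^ j * ipoly (pCons a P) (\<zeta> n))
        = of_int a * (of_nat N * l (\<zeta> n ^ j)) + of_nat N * l (\<zeta> n ^ Suc j * ipoly P (\<zeta> n))"
      by (simp only: l_add l_scale) (simp add: algebra_simps)
    thus ?case
      by (simp only: Ints_add Ints_mult Ints_of_int N_power pCons.IH)
  qed
  from this[of 0] have "of_nat N * l y \<in> \<int>" if "y \<in> cyclotomic_integers n" for y
    using that by (auto elim: cyclotomic_integersE)
  with N_pos show ?thesis by (rule that)
qed

lemma integral_functional_on_cyclotomic_integers:
  assumes n_pos: "n > 0" and x_nonzero: "x \<noteq> 0"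
  obtains \<phi> :: "complex \<Rightarrow> rat"
  where "\<And>q y. \<phi> (of_rat q * y) = q * \<phi> y" "\<phi> x \<noteq> 0"
    "\<And>y. y \<in> cyclotomic_integers n \<Longrightarrow> \<phi> y \<in> \<int>"
proof -
  have "rat_complex.vs1.independent {x}"
    using x_nonzero by (subst rat_complex.vs1.dependent_single) simp
  from rat_complex.linear_independent_extend[OF this, of "\<lambda>_. 1"]
  obtain l where linear: "Vector_Spaces.linear (\<lambda>(q::rat) (z::complex). of_rat q * z) (*) l"
    and l_x: "l x = 1"
    by auto
  have l_add: "l (y + z) = l y + l z" and l_scale: "l (of_rat q * y) = q * l y" for q y z
    using rat_complex.linear_add[OF linear] rat_complex.linear_scale[OF linear] by auto
  obtain N :: nat where "N > 0" "\<And>y. y \<in> cyclotomic_integers n \<Longrightarrow> of_nat N * l y \<in> \<int>"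
    using integral_multiple_of_functional_on_cyclotomic_integers[OF n_pos l_add l_scale] by blast
  thus ?thesis
    using that[of "\<lambda>y. of_nat N * l y"] by (simp add: l_scale l_x)
qed

lemma finite_divisors_of_cyclotomic_integer:
  assumes n_pos: "n > 0" and x_cyclotomic: "x \<in> cyclotomic_integers n"
    and x_nonzero: "x \<noteq> 0"
  shows "finite {m::nat. \<exists>y\<in>cyclotomic_integers n. x = of_nat m * y}"
proof -
  obtain \<phi> :: "complex \<Rightarrow> rat" where phi_scale: "\<And>q y. \<phi> (of_rat q * y) = q * \<phi> y"
    and phi_nonzero: "\<phi> x \<noteq> 0" and phi_integral: "\<And>y. y \<in> cyclotomic_integers n \<Longrightarrow> \<phi> y \<in> \<int>"
    using integral_functional_on_cyclotomic_integers[OF n_pos x_nonzero] by blast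
  obtain c where phi_x: "\<phi> x = of_int c"
    using phi_integral[OF x_cyclotomic] by (rule Ints_cases)
  have "m \<le> nat \<bar>c\<bar>" if y_mult: "y \<in> cyclotomic_integers n" "x = of_nat m * y" for m y
  proof -
    obtain d where "\<phi> y = of_int d"
      using phi_integral[OF y_mult(1)] by (rule Ints_cases)
    hence "of_int c = (of_int (int m * d) :: rat)"
      using phi_scale[of "of_nat m" y] y_mult(2) phi_x by simp
    hence "c = int m * d"
      unfolding of_int_eq_iff .
    thus ?thesis
      using phi_nonzero phi_x dvd_imp_le_int[of c "int m"] by simp
  qed
  hence "{m. \<exists>y\<in>cyclotomic_integers n. x = of_nat m * y} \<subseteq> {..nat \<bar>c\<bar>}"
    by blast
  thus ?thesis by (rule finite_subset) simp
qed

lemma rational_cyclotomic_integer_is_int: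
  assumes n_pos: "n > 0" and x_cyclotomic: "x \<in> cyclotomic_integers n"
    and x_rational: "x \<in> \<rat>"
  shows "x \<in> \<int>"
proof -
  obtain a b :: int where b_pos: "b > 0" and coprime_ab: "coprime a b"
    and x_eq: "x = of_int a / of_int b"
    using x_rational by (rule Rats_cases')
  obtain \<phi> :: "complex \<Rightarrow> rat" where phi_scale: "\<And>q y. \<phi> (of_rat q * y) = q * \<phi> y"
    and phi_nonzero: "\<phi> 1 \<noteq> 0" and phi_integral: "\<And>y. y \<in> cyclotomic_integers n \<Longrightarrow> \<phi> y \<in> \<int>"
    using integral_functional_on_cyclotomic_integers[OF n_pos, of 1] by auto
  obtain c where phi_1: "\<phi> 1 = of_int c"
    using phi_integral[OF of_int_in_cyclotomic_integers[of 1 n, simplified]] by (rule Ints_cases)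
  have "b ^ m dvd c" for m
  proof -
    obtain d where phi_power: "\<phi> (x ^ m) = of_int d"
      using phi_integral[OF cyclotomic_integers_power[OF x_cyclotomic]] by (rule Ints_cases)
    have "x ^ m = of_rat ((of_int a / of_int b) ^ m) * 1"
      by (simp add: x_eq of_rat_divide of_rat_power)
    hence "of_int (a ^ m * c) = (of_int (d * b ^ m) :: rat)"
      using phi_power b_pos by (simp only: phi_scale phi_1) (simp add: field_simps)
    hence "b ^ m dvd a ^ m * c"
      unfolding of_int_eq_iff by simp
    thus ?thesis
      using coprime_ab by (simp add: coprime_dvd_mult_right_iff coprime_commute)
  qed
  hence "is_unit b"
    using finite_divisor_powers[of c b] phi_nonzero phi_1 by auto
  thus ?thesis using b_pos x_eq by simp
qed

section \<open>Irreducibility of the cyclotomic polynomials\<close>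

lemma coprime_residue_avoiding_primes:
  fixes k n :: nat
  assumes n_pos: "n > 0" and coprime_k: "coprime k n"
    and finite_B: "finite B" and primes_B: "\<And>q. q \<in> B \<Longrightarrow> prime q"
  obtains m where "m > 0" "[m = k] (mod n)" "\<And>q. q \<in> B \<Longrightarrow> \<not> q dvd m"
proof
  let ?Q = "\<Prod>q\<in>{q\<in>B. \<not> q dvd k}. q"
  have Q_pos: "?Q > 0"
    using primes_B by (auto intro!: prod_pos simp: prime_gt_0_nat)
  thus "k + n * ?Q > 0"
    using n_pos by simp
  show "[k + n * ?Q = k] (mod n)"
    by (simp add: cong_def)
  fix q assume q_in_B: "q \<in> B"
  hence "prime q" using primes_B by blast
  show "\<not> q dvd k + n * ?Q"
  proof (cases "q dvd k")
    case True
    hence "\<not> q dvd n"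
      using coprime_k \<open>prime q\<close> by (meson coprime_common_divisor not_prime_unit)
    moreover have "\<not> q dvd ?Q"
      using \<open>prime q\<close> finite_B primes_B True primes_dvd_imp_eq[of q]
      by (auto simp: prime_dvd_prod_iff)
    ultimately show ?thesis
      using True \<open>prime q\<close> by (simp add: dvd_add_right_iff prime_dvd_mult_iff)
  next
    case False
    hence "q dvd ?Q"
      using finite_B q_in_B by (intro dvd_prodI) auto
    thus ?thesis
      using False by (simp add: dvd_add_left_iff)
  qed
qed

lemma prime_dvd_ipoly_zeta_power:
  assumes prime_p: "prime p" and root: "ipoly P (\<zeta> n ^ l) = 0"
  shows "\<exists>y\<in>cyclotomic_integers n. ipoly P (\<zeta> n ^ (p * l)) = of_nat p * y"
proof -
  obtain H where "ipoly P (\<zeta> n ^ l) ^ p = ipoly P ((\<zeta> n ^ l) ^ p) + of_nat p * ipoly H (\<zeta> n ^ l)"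
    by (rule ipoly_frobenius[OF prime_p])
  hence "ipoly P (\<zeta> n ^ (p * l)) = of_nat p * ipoly (- H) (\<zeta> n ^ l)"
    using root prime_p
    by (simp add: zero_power prime_gt_0_nat mult.commute add_eq_0_iff2 flip: power_mult)
  thus ?thesis
    using ipoly_zeta_power_in_cyclotomic_integers by blast
qed

lemma finite_primes_moving_roots:
  assumes n_pos: "n > 0"
  shows "finite {p. prime p \<and> (\<exists>l. ipoly P (\<zeta> n ^ l) = 0 \<and> ipoly P (\<zeta> n ^ (p * l)) \<noteq> 0)}"
    (is "finite ?moving")
proof -
  define conjugates where "conjugates = (\<lambda>k. ipoly P (\<zeta> n ^ k)) ` {..<n} - {0}"
  have "?moving \<subseteq> (\<Union>x\<in>conjugates. {p. \<exists>y\<in>cyclotomic_integers n. x = of_nat p * y})"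
  proof
    fix p assume "p \<in> ?moving"
    then obtain l where prime_p: "prime p" and root: "ipoly P (\<zeta> n ^ l) = 0"
      and moved: "ipoly P (\<zeta> n ^ (p * l)) \<noteq> 0"
      by blast
    have "ipoly P (\<zeta> n ^ (p * l)) \<in> (\<lambda>k. ipoly P (\<zeta> n ^ k)) ` {..<n}"
      using n_pos zeta_power_cong[OF n_pos, of "p * l" "p * l mod n"]
      by (intro image_eqI[of _ _ "p * l mod n"]) simp_all
    with moved have "ipoly P (\<zeta> n ^ (p * l)) \<in> conjugates"
      by (simp add: conjugates_def)
    thus "p \<in> (\<Union>x\<in>conjugates. {p. \<exists>y\<in>cyclotomic_integers n. x = of_nat p * y})"
      using prime_dvd_ipoly_zeta_power[OF prime_p root] by blast
  qed
  thus ?thesis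
    by (rule finite_subset)
       (auto simp: conjugates_def intro: finite_divisors_of_cyclotomic_integer[OF n_pos])
qed

text \<open>Landau's proof: \<open>P(\<zeta>\<^sup>l) = 0\<close> forces \<open>p\<close> to divide \<open>P(\<zeta>\<^bsup>pl\<^esup>)\<close>, which hence vanishes
  unless \<open>p\<close> is one of finitely many primes; the residue class of \<open>k\<close> contains a number without
  such prime factors.\<close>
theorem ipoly_zeta_power_eq_0:
  assumes n_pos: "n > 0" and coprime_k: "coprime k n" and root: "ipoly P (\<zeta> n) = 0"
  shows "ipoly P (\<zeta> n ^ k) = 0"
proof -
  define moving where
    "moving = {p. prime p \<and> (\<exists>l. ipoly P (\<zeta> n ^ l) = 0 \<and> ipoly P (\<zeta> n ^ (p * l)) \<noteq> 0)}"
  have "finite moving"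
    unfolding moving_def by (rule finite_primes_moving_roots[OF n_pos])
  moreover have "prime q" if "q \<in> moving" for q
    using that by (simp add: moving_def)
  ultimately obtain m where m_pos: "m > 0" and m_cong: "[m = k] (mod n)"
    and m_avoids: "\<And>q. q \<in> moving \<Longrightarrow> \<not> q dvd m"
    using coprime_residue_avoiding_primes[OF n_pos coprime_k, of moving] by blast
  from m_pos m_avoids have "ipoly P (\<zeta> n ^ m) = 0"
  proof (induction m rule: prime_divisors_induct)
    case (unit m)
    thus ?case using root by simp
  next
    case (factor p m)
    have "\<not> q dvd m" if "q \<in> moving" for q
      using factor.prems(2)[OF that] by auto
    hence "ipoly P (\<zeta> n ^ m) = 0"
      using factor.prems(1) by (intro factor.IH) auto
    moreover have "p \<notin> moving"
      using factor.prems(2)[of p] by auto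
    ultimately show ?case
      using factor.hyps unfolding moving_def by blast
  qed simp
  thus ?thesis
    using zeta_power_cong[OF n_pos m_cong] by simp
qed

section \<open>Galois conjugation of cyclotomic integers\<close>

text \<open>Only meaningful for \<open>k\<close> coprime to \<open>n\<close>: otherwise the value depends on the choice of \<open>P\<close>.\<close>
definition galois :: "nat \<Rightarrow> nat \<Rightarrow> complex \<Rightarrow> complex" where
  "galois n k x = ipoly (SOME P. x = ipoly P (\<zeta> n)) (\<zeta> n ^ k)"

context
  fixes n k :: nat
  assumes n_pos: "n > 0" and coprime_k: "coprime k n"
begin

lemma galois_ipoly [simp]: "galois n k (ipoly P (\<zeta> n)) = ipoly P (\<zeta> n ^ k)"
proof -
  define Q where "Q = (SOME Q. ipoly P (\<zeta> n) = ipoly Q (\<zeta> n))"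
  have "ipoly P (\<zeta> n) = ipoly Q (\<zeta> n)"
    unfolding Q_def by (rule someI) (rule refl)
  hence "ipoly (Q - P) (\<zeta> n ^ k) = 0"
    by (intro ipoly_zeta_power_eq_0[OF n_pos coprime_k]) simp
  thus ?thesis by (simp add: galois_def Q_def)
qed

lemma galois_in_cyclotomic_integers:
  "x \<in> cyclotomic_integers n \<Longrightarrow> galois n k x \<in> cyclotomic_integers n"
  by (elim cyclotomic_integersE) simp

lemma galois_of_int [simp]: "galois n k (of_int c) = of_int c"
  using galois_ipoly[of "of_int c"] by simp

lemma galois_zeta_power: "galois n k (\<zeta> n ^ j) = \<zeta> n ^ (j * k)"
  using galois_ipoly[of "Polynomial.monom 1 j"] by (simp add: mult.commute flip: power_mult)

lemma galois_add:
  assumes "x \<in> cyclotomic_integers n" "y \<in> cyclotomic_integers n"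
  shows "galois n k (x + y) = galois n k x + galois n k y"
proof -
  obtain P Q where "x = ipoly P (\<zeta> n)" "y = ipoly Q (\<zeta> n)"
    using assms by (elim cyclotomic_integersE)
  thus ?thesis using galois_ipoly[of "P + Q"] by simp
qed

lemma galois_mult:
  assumes "x \<in> cyclotomic_integers n" "y \<in> cyclotomic_integers n"
  shows "galois n k (x * y) = galois n k x * galois n k y"
proof -
  obtain P Q where "x = ipoly P (\<zeta> n)" "y = ipoly Q (\<zeta> n)"
    using assms by (elim cyclotomic_integersE)
  thus ?thesis using galois_ipoly[of "P * Q"] by simp
qed

lemma galois_uminus: "x \<in> cyclotomic_integers n \<Longrightarrow> galois n k (- x) = - galois n k x"
  using galois_mult[of "of_int (-1)" x] galois_of_int[of "-1"]
    of_int_in_cyclotomic_integers[of "-1" n] by simp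

lemma galois_power: "x \<in> cyclotomic_integers n \<Longrightarrow> galois n k (x ^ m) = galois n k x ^ m"
  using galois_of_int[of 1]
  by (induction m) (simp_all add: galois_mult cyclotomic_integers_power)

lemma galois_sum:
  "(\<And>i. i \<in> I \<Longrightarrow> x i \<in> cyclotomic_integers n) \<Longrightarrow> galois n k (sum x I) = (\<Sum>i\<in>I. galois n k (x i))"
  using galois_of_int[of 0]
  by (induction I rule: infinite_finite_induct)
     (simp_all add: galois_add cyclotomic_integers_sum)

lemma galois_prod:
  "(\<And>i. i \<in> I \<Longrightarrow> x i \<in> cyclotomic_integers n) \<Longrightarrow> galois n k (prod x I) = (\<Prod>i\<in>I. galois n k (x i))"
  using galois_of_int[of 1]
  by (induction I rule: infinite_finite_induct)
     (simp_all add: galois_mult cyclotomic_integers_prod)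

end

lemma galois_comp:
  assumes n_pos: "n > 0" and coprime: "coprime k n" "coprime l n"
    and x_cyclotomic: "x \<in> cyclotomic_integers n"
  shows "galois n k (galois n l x) = galois n (k * l) x"
proof -
  obtain P where x_eq: "x = ipoly P (\<zeta> n)"
    using x_cyclotomic by (rule cyclotomic_integersE)
  have "galois n k (galois n l x) = galois n k (ipoly (pcompose P (Polynomial.monom 1 l)) (\<zeta> n))"
    using n_pos coprime by (simp add: x_eq)
  also have "\<dots> = ipoly P (\<zeta> n ^ (k * l))"
    unfolding galois_ipoly[OF n_pos coprime(1)] by (simp add: power_mult)
  finally show ?thesis
    using n_pos coprime by (simp add: x_eq)
qed

lemma galois_cong: "n > 0 \<Longrightarrow> [k = l] (mod n) \<Longrightarrow> galois n k = galois n l"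
  by (simp add: galois_def fun_eq_iff zeta_power_cong)

lemma galois_minus_one_eq_cnj:
  assumes "n > 0" "x \<in> cyclotomic_integers n"
  shows "galois n (n - 1) x = cnj x"
  using assms galois_ipoly[OF assms(1) coprime_diff_one_left_nat[OF assms(1)]]
  by (elim cyclotomic_integersE) (simp add: cnj_ipoly cnj_zeta)

lemma units_mod_iff: "k \<in> units_mod n \<longleftrightarrow> k < n \<and> coprime k n"
  by (simp add: units_mod_def)

lemma finite_units_mod [simp]: "finite (units_mod n)"
  by (rule finite_subset[of _ "{..<n}"]) (auto simp: units_mod_def)

lemma sum_ipoly_zeta_powers_in_Ints:
  assumes "n > 0"
  shows "(\<Sum>k<n. ipoly P (\<zeta> n ^ k)) \<in> (\<int> :: complex set)"
proof -
  have "(\<Sum>k<n. \<zeta> n ^ (j * k) * ipoly P (\<zeta> n ^ k)) \<in> \<int>" for j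
  proof (induction P arbitrary: j)
    case (pCons a P)
    have "(\<Sum>k<n. (\<zeta> n ^ j) ^ k) \<in> \<int>"
      using assms sum_powers_root_of_unity[of "\<zeta> n ^ j" n] by simp
    moreover have "\<zeta> n ^ (j * k) * ipoly (pCons a P) (\<zeta> n ^ k)
        = of_int a * (\<zeta> n ^ j) ^ k + \<zeta> n ^ (Suc j * k) * ipoly P (\<zeta> n ^ k)" for k
      by (simp add: algebra_simps power_add power_mult)
    ultimately show ?case
      using pCons.IH[of "Suc j"] by (simp add: sum.distrib flip: sum_distrib_left)
  qed simp
  from this[of 0] show ?thesis by simp
qed

lemma coprime_iff_no_common_prime_factor:
  fixes k n :: nat
  assumes "n > 0"
  shows "coprime k n \<longleftrightarrow> (\<forall>p\<in>prime_factors n. \<not> p dvd k)"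
proof
  assume "coprime k n"
  show "\<forall>p\<in>prime_factors n. \<not> p dvd k"
  proof
    fix p assume "p \<in> prime_factors n"
    hence "prime p" "p dvd n"
      by auto
    thus "\<not> p dvd k"
      using \<open>coprime k n\<close> coprime_common_divisor_nat[of k n p] by auto
  qed
next
  assume no_common: "\<forall>p\<in>prime_factors n. \<not> p dvd k"
  show "coprime k n"
  proof (rule ccontr)
    assume "\<not> coprime k n"
    hence "gcd k n \<noteq> 1"
      using gcd_eq_1_imp_coprime by blast
    then obtain p where "prime p" "p dvd gcd k n"
      using prime_factor_nat by blast
    thus False
      using no_common assms by (auto simp: prime_factors_dvd)
  qed
qed

text \<open>The factor \<open>p - \<Sum>\<^sub>i\<^sub><\<^sub>p \<zeta>\<^sub>p\<^bsup>ik\<^esup>\<close> of the witness is \<open>0\<close> if \<open>p\<close> divides \<open>k\<close>, else \<open>p\<close>.\<close>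
lemma coprime_indicator_ipoly:
  assumes n_pos: "n > 0"
  obtains P where "\<And>k. ipoly P (\<zeta> n ^ k) = of_nat (\<Prod>(prime_factors n)) * of_bool (coprime k n)"
proof
  define P :: "int poly" where
    "P = (\<Prod>p\<in>prime_factors n. of_nat p - (\<Sum>i<p. Polynomial.monom 1 (n div p * i)))"
  fix k
  have factor_value: "ipoly (of_nat p - (\<Sum>i<p. Polynomial.monom 1 (n div p * i))) (\<zeta> n ^ k)
      = (of_nat p * of_bool (\<not> p dvd k) :: complex)"
    if prime_factor_p: "p \<in> prime_factors n" for p
  proof -
    have "p > 0" "p dvd n"
      using prime_factor_p by (auto intro: prime_gt_0_nat)
    have "(\<zeta> n ^ k) ^ (n div p * i) = (\<zeta> p ^ k) ^ i" for i
      by (simp add: zeta_power_div[OF n_pos \<open>p dvd n\<close>, symmetric] mult_ac flip: power_mult)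
    moreover have "(\<Sum>i<p. (\<zeta> p ^ k) ^ i) = (if \<zeta> p ^ k = 1 then of_nat p else 0)"
      using \<open>p > 0\<close> by (intro sum_powers_root_of_unity) simp
    ultimately show ?thesis
      using \<open>p > 0\<close> by (simp add: zeta_power_eq_1_iff)
  qed
  have "ipoly P (\<zeta> n ^ k) = (\<Prod>p\<in>prime_factors n. of_nat p * of_bool (\<not> p dvd k))"
    unfolding P_def ipoly_prod by (intro prod.cong refl factor_value)
  moreover have "(\<Prod>p\<in>A. of_bool (Q p) :: complex) = of_bool (\<forall>p\<in>A. Q p)" if "finite A" for A Q
    using that by induction auto
  ultimately show "ipoly P (\<zeta> n ^ k) = of_nat (\<Prod>(prime_factors n)) * of_bool (coprime k n)"
    by (simp add: prod.distrib coprime_iff_no_common_prime_factor[OF n_pos])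
qed

lemma Rats_if_nat_multiple_in_Ints:
  fixes x :: "'a::field_char_0"
  assumes "of_nat N * x \<in> \<int>" "N > 0"
  shows "x \<in> \<rat>"
proof -
  obtain z where "of_nat N * x = of_int z"
    using assms(1) by (rule Ints_cases)
  hence "x = of_int z / of_nat N"
    using assms(2) by (simp add: field_simps)
  thus ?thesis by simp
qed

lemma trace_in_Ints:
  assumes n_pos: "n > 0" and x_cyclotomic: "x \<in> cyclotomic_integers n"
  shows "(\<Sum>k\<in>units_mod n. galois n k x) \<in> \<int>"
proof -
  obtain P where x_eq: "x = ipoly P (\<zeta> n)"
    using x_cyclotomic by (rule cyclotomic_integersE)
  obtain I where indicator:
      "\<And>k. ipoly I (\<zeta> n ^ k) = of_nat (\<Prod>(prime_factors n)) * of_bool (coprime k n)"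
    using coprime_indicator_ipoly[OF n_pos] by blast
  define N where "N = \<Prod>(prime_factors n)"
  have "N > 0"
    by (auto simp: N_def intro!: prod_pos prime_gt_0_nat)
  have galois_P: "galois n k x = ipoly P (\<zeta> n ^ k)" if "k \<in> units_mod n" for k
    using n_pos that by (simp add: x_eq units_mod_iff)
  have "(\<Sum>k<n. ipoly (I * P) (\<zeta> n ^ k)) = (\<Sum>k\<in>units_mod n. of_nat N * ipoly P (\<zeta> n ^ k))"
    by (rule sum.mono_neutral_cong_right) (auto simp: units_mod_iff indicator N_def)
  also have "\<dots> = of_nat N * (\<Sum>k\<in>units_mod n. galois n k x)"
    by (simp add: galois_P sum_distrib_left)
  finally have "of_nat N * (\<Sum>k\<in>units_mod n. galois n k x) \<in> \<int>"
    using sum_ipoly_zeta_powers_in_Ints[OF n_pos, of "I * P"] by simp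
  hence "(\<Sum>k\<in>units_mod n. galois n k x) \<in> \<rat>"
    using \<open>N > 0\<close> by (intro Rats_if_nat_multiple_in_Ints)
  moreover have "(\<Sum>k\<in>units_mod n. galois n k x) \<in> cyclotomic_integers n"
    using n_pos x_cyclotomic
    by (intro cyclotomic_integers_sum galois_in_cyclotomic_integers) (auto simp: units_mod_iff)
  ultimately show ?thesis
    using rational_cyclotomic_integer_is_int[OF n_pos] by blast
qed

lemma galois_fixed_imp_in_Ints:
  assumes n_pos: "n > 0" and x_cyclotomic: "x \<in> cyclotomic_integers n"
    and fixed: "\<And>k. k \<in> units_mod n \<Longrightarrow> galois n k x = x"
  shows "x \<in> \<int>"
proof -
  have "1 mod n \<in> units_mod n"
    using n_pos by (simp add: units_mod_iff coprime_mod_left_iff)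
  hence units_nonempty: "units_mod n \<noteq> {}"
    by auto
  have "of_nat (card (units_mod n)) * x \<in> \<int>"
    using trace_in_Ints[OF n_pos x_cyclotomic] by (simp add: fixed)
  hence "x \<in> \<rat>"
    by (rule Rats_if_nat_multiple_in_Ints) (use units_nonempty in \<open>simp add: card_gt_0_iff\<close>)
  thus ?thesis
    using rational_cyclotomic_integer_is_int[OF n_pos x_cyclotomic] by blast
qed

section \<open>Quadratic fields inside cyclotomic fields\<close>

lemma squarefree_dvd_power_imp_dvd:
  fixes a b :: "'a::factorial_semiring"
  assumes "squarefree a" "a dvd b ^ m" "b \<noteq> 0"
  shows "a dvd b"
proof (rule multiplicity_le_imp_dvd)
  show "a \<noteq> 0"
    using assms(1) by auto
  fix p :: 'a assume prime_p: "prime p"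
  show "multiplicity p a \<le> multiplicity p b"
  proof (cases "p dvd a")
    case True
    hence "p dvd b"
      using prime_p assms(2) by (meson dvd_trans prime_dvd_power)
    hence "multiplicity p b \<ge> 1"
      using prime_p assms(3) by (intro multiplicity_geI) auto
    moreover have "multiplicity p a < 2"
      using assms(1) prime_p True by (intro multiplicity_lessI) (auto dest: squarefreeD)
    ultimately show ?thesis by simp
  next
    case False
    thus ?thesis by (simp add: not_dvd_imp_multiplicity_0)
  qed
qed

lemma squarefree_square_imp_eq_1:
  fixes D z :: int
  assumes "squarefree D" "z ^ 2 = D"
  shows "D = 1"
proof -
  have "z dvd 1"
    using assms squarefreeD[of D z] by simp
  thus ?thesis
    using assms(2) by (auto simp: zdvd1_eq abs_if split: if_splits)
qed

lemma in_Q_sqrt_iff_integral_relation: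
  "c \<in> Q_sqrt D \<longleftrightarrow>
     (\<exists>N a b :: int. N \<noteq> 0 \<and> of_int N * c = of_int a + of_int b * csqrt (of_int D))"
proof
  assume "c \<in> Q_sqrt D"
  then obtain p q :: real where rational: "p \<in> \<rat>" "q \<in> \<rat>"
    and c_eq: "c = of_real p + of_real q * csqrt (of_int D)"
    by (auto simp: Q_sqrt_def)
  obtain a d where d_pos: "d > 0" and p_eq: "p = of_int a / of_int d"
    using rational(1) by (rule Rats_cases')
  obtain b e where e_pos: "e > 0" and q_eq: "q = of_int b / of_int e"
    using rational(2) by (rule Rats_cases')
  have "of_int (d * e) * c = of_int (a * e) + of_int (b * d) * csqrt (of_int D)"
    unfolding c_eq p_eq q_eq using d_pos e_pos by (simp add: field_simps)
  thus "\<exists>N a b :: int. N \<noteq> 0 \<and> of_int N * c = of_int a + of_int b * csqrt (of_int D)"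
    using d_pos e_pos by (intro exI[of _ "d * e"] exI[of _ "a * e"] exI[of _ "b * d"]) simp
next
  assume "\<exists>N a b :: int. N \<noteq> 0 \<and> of_int N * c = of_int a + of_int b * csqrt (of_int D)"
  then obtain N a b :: int where "N \<noteq> 0" "of_int N * c = of_int a + of_int b * csqrt (of_int D)"
    by blast
  hence "c = of_real (of_int a / of_int N) + of_real (of_int b / of_int N) * csqrt (of_int D)"
    by (simp add: field_simps)
  thus "c \<in> Q_sqrt D"
    unfolding Q_sqrt_def by (blast intro: Rats_divide Rats_of_int)
qed

locale quadratic_cyclotomic =
  fixes n :: nat and D :: int
  assumes n_pos: "n > 0"
    and squarefree_D: "squarefree D"
    and sqrt_D_cyclotomic: "csqrt (of_int D) \<in> cyclotomic_integers n"
begin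

abbreviation sqrt_D :: complex (\<open>\<delta>\<close>) where
  "\<delta> \<equiv> csqrt (of_int D)"

definition quadratic_sign :: "nat \<Rightarrow> int" (\<open>\<epsilon>\<close>) where
  "\<epsilon> k = (if galois n k \<delta> = \<delta> then 1 else - 1)"

abbreviation sign_kernel :: "nat set" (\<open>H\<close>) where
  "H \<equiv> {k \<in> units_mod n. \<epsilon> k = 1}"

lemma D_nonzero: "D \<noteq> 0"
  using squarefree_D by auto

lemma sqrt_D_nonzero: "\<delta> \<noteq> 0"
  using D_nonzero by simp

lemma sqrt_D_mult_self: "\<delta> * \<delta> = of_int D"
  by (simp flip: power2_eq_square)

lemma sign_cases: "\<epsilon> k = 1 \<or> \<epsilon> k = - 1"
  by (simp add: quadratic_sign_def)

lemma galois_sqrt_D: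
  assumes "coprime k n"
  shows "galois n k \<delta> = of_int (\<epsilon> k) * \<delta>"
proof -
  have "galois n k \<delta> ^ 2 = galois n k (\<delta> ^ 2)"
    using n_pos assms sqrt_D_cyclotomic by (simp only: galois_power)
  also have "\<dots> = \<delta> ^ 2"
    using galois_of_int[OF n_pos assms] by simp
  finally have "galois n k \<delta> = \<delta> \<or> galois n k \<delta> = - \<delta>"
    by (simp only: power2_eq_iff)
  thus ?thesis
    by (auto simp: quadratic_sign_def)
qed

lemma sign_eqI:
  assumes "coprime k n" "galois n k \<delta> = of_int s * \<delta>"
  shows "\<epsilon> k = s"
  using assms galois_sqrt_D[OF assms(1)] sqrt_D_nonzero by simp

lemma sign_mult:
  assumes "coprime k n" "coprime l n"
  shows "\<epsilon> (k * l) = \<epsilon> k * \<epsilon> l"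
proof (rule sign_eqI)
  have "galois n (k * l) \<delta> = galois n k (of_int (\<epsilon> l) * \<delta>)"
    using assms n_pos sqrt_D_cyclotomic by (simp flip: galois_comp add: galois_sqrt_D)
  also have "\<dots> = of_int (\<epsilon> k * \<epsilon> l) * \<delta>"
    using assms n_pos sqrt_D_cyclotomic by (simp add: galois_mult galois_sqrt_D)
  finally show "galois n (k * l) \<delta> = of_int (\<epsilon> k * \<epsilon> l) * \<delta>" .
qed (use assms in simp)

lemma sign_mod: "\<epsilon> (k mod n) = \<epsilon> k"
  using galois_cong[OF n_pos, of "k mod n" k] by (simp add: quadratic_sign_def)

lemma sign_minus_one: "\<epsilon> (n - 1) = sgn D"
proof (rule sign_eqI)
  show "coprime (n - 1) n"
    using n_pos by (rule coprime_diff_one_left_nat)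
  have "galois n (n - 1) \<delta> = cnj \<delta>"
    by (rule galois_minus_one_eq_cnj[OF n_pos sqrt_D_cyclotomic])
  also have "\<dots> = of_int (sgn D) * \<delta>"
  proof (cases "D > 0")
    case False
    hence "\<delta> = \<i> * of_real (sqrt \<bar>of_int D\<bar>)"
      by simp
    thus ?thesis using False D_nonzero by simp
  qed simp
  finally show "galois n (n - 1) \<delta> = of_int (sgn D) * \<delta>" .
qed

lemma D_eq_1_iff: "D = 1 \<longleftrightarrow> (\<forall>k\<in>units_mod n. \<epsilon> k = 1)"
proof
  assume "D = 1"
  thus "\<forall>k\<in>units_mod n. \<epsilon> k = 1"
    unfolding quadratic_sign_def using galois_of_int[OF n_pos, of _ 1]
    by (simp add: units_mod_iff)
next
  assume "\<forall>k\<in>units_mod n. \<epsilon> k = 1"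
  hence "\<delta> \<in> \<int>"
    by (intro galois_fixed_imp_in_Ints[OF n_pos sqrt_D_cyclotomic])
       (auto simp: galois_sqrt_D units_mod_iff)
  then obtain z where "\<delta> = of_int z"
    by (rule Ints_cases)
  hence "of_int (z ^ 2) = (of_int D :: complex)"
    using sqrt_D_mult_self by (simp add: power2_eq_square)
  hence "z ^ 2 = D"
    by (simp only: of_int_eq_iff)
  thus "D = 1"
    by (rule squarefree_square_imp_eq_1[OF squarefree_D])
qed

lemma galois_of_integral_relation:
  assumes coprime_k: "coprime k n" and x_cyclotomic: "x \<in> cyclotomic_integers n"
    and relation: "of_int N * x = of_int a + of_int b * \<delta>"
  shows "of_int N * galois n k x = of_int a + of_int b * (of_int (\<epsilon> k) * \<delta>)"
proof -
  have "galois n k (of_int N * x) = galois n k (of_int a + of_int b * \<delta>)"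
    by (simp only: relation)
  thus ?thesis
    using n_pos coprime_k x_cyclotomic sqrt_D_cyclotomic
    by (simp add: galois_add galois_mult cyclotomic_integers_mult galois_sqrt_D)
qed

lemma sum_twisted_galois:
  assumes fixed: "\<And>k. k \<in> units_mod n \<Longrightarrow> \<epsilon> k = 1 \<Longrightarrow> galois n k x = x"
  shows "(\<Sum>k\<in>units_mod n. galois n k x + of_int (\<epsilon> k) * galois n k x)
    = of_nat (card H) * (2 * x)"
proof -
  have "galois n k x + of_int (\<epsilon> k) * galois n k x = (if \<epsilon> k = 1 then 2 * x else 0)"
    if "k \<in> units_mod n" for k
    using sign_cases[of k] fixed[OF that] by auto
  hence "(\<Sum>k\<in>units_mod n. galois n k x + of_int (\<epsilon> k) * galois n k x)
      = (\<Sum>k\<in>units_mod n. if \<epsilon> k = 1 then 2 * x else 0)"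
    by (rule sum.cong[OF refl])
  thus ?thesis
    by (simp flip: sum.inter_filter)
qed

lemma sign_kernel_nonempty: "H \<noteq> {}"
proof -
  have "\<epsilon> 1 = 1"
    using sign_mult[of 1 1] sign_cases[of 1] by auto
  hence "\<epsilon> (1 mod n) = 1"
    by (simp only: sign_mod)
  hence "1 mod n \<in> H"
    using n_pos by (simp add: units_mod_iff coprime_mod_left_iff)
  thus ?thesis by blast
qed

text \<open>The traces of \<open>x\<close> and \<open>x \<delta>\<close> are rational, and the second divided by \<open>\<delta>\<close> is the sum of the
  conjugates of \<open>x\<close> twisted by \<open>\<epsilon>\<close>; adding both leaves only conjugates with \<open>\<epsilon> k = 1\<close>.\<close>
lemma galois_fixed_imp_in_Q_sqrt:
  assumes x_cyclotomic: "x \<in> cyclotomic_integers n"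
    and fixed: "\<And>k. k \<in> units_mod n \<Longrightarrow> \<epsilon> k = 1 \<Longrightarrow> galois n k x = x"
  shows "x \<in> Q_sqrt D"
proof -
  let ?U = "units_mod n"
  have card_nonzero: "int (card H) \<noteq> 0"
    using sign_kernel_nonempty by (simp add: card_eq_0_iff)
  obtain a where trace_x: "(\<Sum>k\<in>?U. galois n k x) = of_int a"
    using trace_in_Ints[OF n_pos x_cyclotomic] by (rule Ints_cases)
  have "x * \<delta> \<in> cyclotomic_integers n"
    by (intro cyclotomic_integers_mult x_cyclotomic sqrt_D_cyclotomic)
  then obtain b where trace_x_sqrt: "(\<Sum>k\<in>?U. galois n k (x * \<delta>)) = of_int b"
    using trace_in_Ints[OF n_pos] Ints_cases by metis
  have "galois n k (x * \<delta>) = of_int (\<epsilon> k) * galois n k x * \<delta>" if "k \<in> ?U" for k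
    using that n_pos x_cyclotomic sqrt_D_cyclotomic
    by (simp add: units_mod_iff galois_mult galois_sqrt_D)
  hence b_twisted: "of_int b = (\<Sum>k\<in>?U. of_int (\<epsilon> k) * galois n k x) * \<delta>"
    by (simp add: sum_distrib_right flip: trace_x_sqrt)
  have "of_int a * of_int D + of_int b * \<delta>
      = (\<Sum>k\<in>?U. galois n k x + of_int (\<epsilon> k) * galois n k x) * of_int D"
    by (simp add: trace_x b_twisted mult.assoc sqrt_D_mult_self sum.distrib distrib_right)
  hence "of_int (2 * int (card H) * D) * x = of_int (a * D) + of_int b * \<delta>"
    by (simp add: sum_twisted_galois[OF fixed])
  moreover have "2 * int (card H) * D \<noteq> 0"
    using card_nonzero D_nonzero by simp
  ultimately show ?thesis
    unfolding in_Q_sqrt_iff_integral_relation by blast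
qed

theorem in_Q_sqrt_iff_galois_fixed:
  assumes x_cyclotomic: "x \<in> cyclotomic_integers n"
  shows "x \<in> Q_sqrt D \<longleftrightarrow> (\<forall>k\<in>units_mod n. \<epsilon> k = 1 \<longrightarrow> galois n k x = x)"
proof
  assume "x \<in> Q_sqrt D"
  then obtain N a b where N_nonzero: "N \<noteq> 0"
    and relation: "of_int N * x = of_int a + of_int b * \<delta>"
    unfolding in_Q_sqrt_iff_integral_relation by blast
  show "\<forall>k\<in>units_mod n. \<epsilon> k = 1 \<longrightarrow> galois n k x = x"
  proof (intro ballI impI)
    fix k assume "k \<in> units_mod n" "\<epsilon> k = 1"
    hence "of_int N * galois n k x = of_int N * x"
      using galois_of_integral_relation[OF _ x_cyclotomic relation, of k]
      by (simp add: units_mod_iff relation)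
    thus "galois n k x = x" using N_nonzero by simp
  qed
qed (use galois_fixed_imp_in_Q_sqrt[OF x_cyclotomic] in blast)

lemma galois_twisted_imp_in_int_mult_sqrt:
  assumes x_cyclotomic: "x \<in> cyclotomic_integers n"
    and twisted: "\<And>k. k \<in> units_mod n \<Longrightarrow> galois n k x = of_int (\<epsilon> k) * x"
  shows "x \<in> int_mult_sqrt D"
proof -
  have sign_square: "(of_int (\<epsilon> k) * y) * (of_int (\<epsilon> k) * z) = y * z" for k and y z :: complex
    using sign_cases[of k] by auto
  have "x * \<delta> \<in> \<int>"
    using twisted n_pos x_cyclotomic sqrt_D_cyclotomic
    by (intro galois_fixed_imp_in_Ints[OF n_pos] cyclotomic_integers_mult)
       (simp_all add: galois_mult galois_sqrt_D sign_square units_mod_iff)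
  then obtain z where z_eq: "x * \<delta> = of_int z"
    by (rule Ints_cases)
  have "x * x \<in> \<int>"
    using twisted n_pos x_cyclotomic
    by (intro galois_fixed_imp_in_Ints[OF n_pos] cyclotomic_integers_mult)
       (simp_all add: galois_mult sign_square units_mod_iff)
  then obtain x_square where x_square: "x * x = of_int x_square"
    by (rule Ints_cases)
  have "of_int (z ^ 2) = (x * \<delta>) * (x * \<delta>)"
    by (simp add: z_eq power2_eq_square)
  also have "\<dots> = (\<delta> * \<delta>) * (x * x)"
    by (simp only: mult_ac)
  also have "\<dots> = of_int (D * x_square)"
    by (simp only: sqrt_D_mult_self x_square of_int_mult)
  finally have "D dvd z ^ 2"
    by (simp only: of_int_eq_iff dvd_triv_left)
  hence "D dvd z"
    using squarefree_dvd_power_imp_dvd[OF squarefree_D] by (cases "z = 0") auto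
  then obtain y where "z = D * y" ..
  hence "x * \<delta> = (of_int y * \<delta>) * \<delta>"
    by (simp only: z_eq of_int_mult mult.assoc sqrt_D_mult_self) (rule mult.commute)
  thus ?thesis
    using sqrt_D_nonzero by (auto simp: int_mult_sqrt_def)
qed

theorem in_int_mult_sqrt_iff_galois_twisted:
  assumes x_cyclotomic: "x \<in> cyclotomic_integers n"
  shows "x \<in> int_mult_sqrt D \<longleftrightarrow> (\<forall>k\<in>units_mod n. galois n k x = of_int (\<epsilon> k) * x)"
proof
  assume "x \<in> int_mult_sqrt D"
  then obtain z where x_eq: "x = of_int z * \<delta>"
    by (auto simp: int_mult_sqrt_def)
  show "\<forall>k\<in>units_mod n. galois n k x = of_int (\<epsilon> k) * x"
    using galois_of_integral_relation[OF _ x_cyclotomic, of _ 1 0 z]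
    by (simp add: x_eq units_mod_iff)
qed (use galois_twisted_imp_in_int_mult_sqrt[OF x_cyclotomic] in blast)

end

section \<open>Quadratic Gauss sums\<close>

lemma Legendre_cong: "[a = b] (mod p) \<Longrightarrow> Legendre a p = Legendre b p"
  unfolding Legendre_def QuadRes_def by (smt (verit) cong_sym cong_trans)

lemma abs_Legendre_le_1: "\<bar>Legendre a p\<bar> \<le> 1"
  by (simp add: Legendre_def)

lemma Legendre_eq_0_iff: "Legendre a p = 0 \<longleftrightarrow> p dvd a"
  by (simp add: Legendre_def cong_0_iff)

lemma Legendre_square: "\<not> p dvd a \<Longrightarrow> Legendre a p * Legendre a p = 1"
  by (simp add: Legendre_def cong_0_iff)

lemma eq_if_cong_mod_gt_2:
  fixes a b p :: int
  assumes "[a = b] (mod p)" "\<bar>a\<bar> \<le> 1" "\<bar>b\<bar> \<le> 1" "2 < p"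
  shows "a = b"
proof (rule ccontr)
  assume "a \<noteq> b"
  hence "\<bar>p\<bar> \<le> \<bar>a - b\<bar>"
    using assms(1) by (intro dvd_imp_le_int) (simp_all add: cong_iff_dvd_diff)
  thus False using assms by linarith
qed

definition gauss_sum :: "nat \<Rightarrow> complex \<Rightarrow> complex" where
  "gauss_sum p z = (\<Sum>j<p. of_int (Legendre (int j) (int p)) * z ^ j)"

lemma bij_betw_mult_mod:
  fixes a n :: nat
  assumes "coprime a n" "n > 0"
  shows "bij_betw (\<lambda>j. a * j mod n) {..<n} {..<n}"
proof -
  have "inj_on (\<lambda>j. a * j mod n) {..<n}"
    using assms(1) cong_mult_lcancel_nat[of a n] by (auto simp: inj_on_def cong_def)
  moreover have "(\<lambda>j. a * j mod n) ` {..<n} \<subseteq> {..<n}"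
    using assms(2) by auto
  ultimately show ?thesis
    by (simp add: bij_betw_def endo_inj_surj)
qed

context
  fixes p :: nat
  assumes prime_p: "prime p" and p_gt_2: "2 < p"
begin

lemma Legendre_mult: "Legendre (a * b) p = Legendre a p * Legendre b p"
proof (rule eq_if_cong_mod_gt_2)
  have "[Legendre a p * Legendre b p = a ^ ((p - 1) div 2) * b ^ ((p - 1) div 2)] (mod p)"
    by (intro cong_mult euler_criterion prime_p p_gt_2)
  thus "[Legendre (a * b) p = Legendre a p * Legendre b p] (mod p)"
    using euler_criterion[OF prime_p p_gt_2, of "a * b"]
    by (metis cong_sym cong_trans power_mult_distrib)
  show "\<bar>Legendre a p * Legendre b p\<bar> \<le> 1"
    by (simp add: abs_mult mult_le_one abs_Legendre_le_1)
qed (use p_gt_2 abs_Legendre_le_1 in auto)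

lemma Legendre_minus_one: "Legendre (- 1) p = (- 1) ^ ((p - 1) div 2)"
  using euler_criterion[OF prime_p p_gt_2, of "- 1"] p_gt_2
  by (intro eq_if_cong_mod_gt_2[of _ _ p]) (simp_all add: abs_Legendre_le_1 power_abs)

lemma exists_quadratic_nonresidue:
  obtains a :: nat where "coprime a p" "Legendre a p = - 1"
proof -
  obtain g where primroot_g: "residue_primroot p g"
    using prime_primitive_root_exists[of p] prime_p p_gt_2 by auto
  hence ord_g: "ord p g = p - 1" and coprime_g: "coprime g p"
    using prime_p by (simp_all add: residue_primroot_def totient_prime coprime_commute)
  have "\<not> [g ^ ((p - 1) div 2) = 1] (mod p)"
    using ord_g p_gt_2 by (simp add: ord_divides' nat_dvd_not_less)
  hence "\<not> [int g ^ ((p - 1) div 2) = 1] (mod p)"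
    by (metis cong_int_iff of_nat_1 of_nat_power)
  hence "Legendre g p \<noteq> 1"
    using euler_criterion[OF prime_p p_gt_2, of g] by (metis cong_sym)
  moreover have "Legendre g p \<noteq> 0"
    using coprime_g prime_p by (auto simp: Legendre_eq_0_iff dest: coprime_common_divisor_nat)
  ultimately have "Legendre g p = - 1"
    by (auto simp: Legendre_def split: if_splits)
  thus ?thesis using that coprime_g by blast
qed

lemma gauss_sum_power_coprime:
  assumes z_root: "z ^ p = 1" and coprime_a: "coprime a p"
  shows "gauss_sum p (z ^ a) = of_int (Legendre a p) * gauss_sum p z"
proof -
  have "gauss_sum p z = (\<Sum>j<p. of_int (Legendre (a * j mod p) p) * z ^ (a * j mod p))"
    unfolding gauss_sum_def using p_gt_2
    by (intro sum.reindex_bij_betw[OF bij_betw_mult_mod[OF coprime_a], symmetric]) simp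
  also have "\<dots> = (\<Sum>j<p. of_int (Legendre a p) * (of_int (Legendre j p) * (z ^ a) ^ j))"
  proof (intro sum.cong refl)
    fix j
    have "Legendre (a * j mod p) p = Legendre a p * Legendre j p"
      using Legendre_cong[of "int (a * j mod p)" "int a * int j" p] Legendre_mult
      by (simp add: zmod_int)
    thus "of_int (Legendre (a * j mod p) p) * z ^ (a * j mod p)
        = of_int (Legendre a p) * (of_int (Legendre j p) * (z ^ a) ^ j)"
      by (simp add: root_of_unity_power_mod[OF z_root] power_mult)
  qed
  also have "\<dots> = of_int (Legendre a p) * gauss_sum p (z ^ a)"
    by (simp add: gauss_sum_def sum_distrib_left)
  finally have "of_int (Legendre a p) * gauss_sum p z
      = of_int (Legendre a p * Legendre a p) * gauss_sum p (z ^ a)"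
    by simp
  moreover have "\<not> int p dvd int a"
    using coprime_a prime_p by (auto dest: coprime_common_divisor_nat)
  hence "Legendre a p * Legendre a p = 1"
    by (rule Legendre_square)
  ultimately show ?thesis
    by (simp only: of_int_1 mult_1)
qed

lemma gauss_sum_one: "gauss_sum p 1 = 0"
proof -
  obtain a :: nat where "coprime a p" "Legendre a p = - 1"
    by (rule exists_quadratic_nonresidue)
  hence "gauss_sum p 1 = - gauss_sum p 1"
    using gauss_sum_power_coprime[of 1 a] by simp
  thus ?thesis by simp
qed

lemma gauss_sum_power:
  assumes z_root: "z ^ p = 1"
  shows "gauss_sum p (z ^ a) = of_int (Legendre a p) * gauss_sum p z"
proof (cases "p dvd a")
  case True
  thus ?thesis
    using z_root by (auto simp: power_mult gauss_sum_one Legendre_eq_0_iff)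
next
  case False
  hence "coprime a p"
    using prime_p prime_imp_coprime[of p a] by (simp add: coprime_commute)
  thus ?thesis by (rule gauss_sum_power_coprime[OF z_root])
qed

lemma gauss_sum_square: "gauss_sum p (\<zeta> p) ^ 2 = of_int (pstar p)"
proof -
  let ?z = "\<zeta> p"
  have p_pos: "p > 0"
    using p_gt_2 by simp
  have "gauss_sum p ?z ^ 2 = (\<Sum>j<p. (of_int (Legendre j p) * gauss_sum p ?z) * ?z ^ j)"
    by (simp add: power2_eq_square gauss_sum_def[of p ?z] sum_distrib_left sum_distrib_right
        mult_ac)
  also have "\<dots> = (\<Sum>j<p. gauss_sum p (?z ^ j) * ?z ^ j)"
    using p_pos by (simp add: gauss_sum_power)
  also have "\<dots> = (\<Sum>j<p. \<Sum>l<p. of_int (Legendre l p) * (?z ^ Suc l) ^ j)"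
    unfolding gauss_sum_def sum_distrib_right
    by (intro sum.cong refl) (simp add: power_mult_distrib mult_ac flip: power_mult)
  also have "\<dots> = (\<Sum>l<p. of_int (Legendre l p) * (\<Sum>j<p. (?z ^ Suc l) ^ j))"
    by (subst sum.swap) (simp only: sum_distrib_left)
  also have "\<dots> = (\<Sum>l<p. if l = p - 1 then of_int (Legendre l p) * of_nat p else 0)"
  proof (intro sum.cong refl)
    fix l assume "l \<in> {..<p}"
    hence "?z ^ Suc l = 1 \<longleftrightarrow> l = p - 1"
      unfolding zeta_power_eq_1_iff[OF p_pos] using dvd_imp_le[of p "Suc l"] by auto
    thus "of_int (Legendre l p) * (\<Sum>j<p. (?z ^ Suc l) ^ j)
        = (if l = p - 1 then of_int (Legendre l p) * of_nat p else 0)"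
      using sum_powers_root_of_unity[of "?z ^ Suc l" p] p_pos by (simp del: power_Suc)
  qed
  also have "\<dots> = of_int (Legendre (int (p - 1)) p) * of_nat p"
    using p_pos by simp
  also have "Legendre (int (p - 1)) p = Legendre (- 1) p"
    using p_pos by (intro Legendre_cong) (simp add: of_nat_diff cong_iff_dvd_diff)
  also have "\<dots> = (- 1) ^ ((p - 1) div 2)"
    by (rule Legendre_minus_one)
  finally show ?thesis by (simp add: pstar_def)
qed

end

section \<open>The square root of \<open>\<Delta>\<close>\<close>

lemma zeta_4: "\<zeta> 4 = \<i>"
  by (simp add: root_of_unity_def)

lemma ii_power_odd:
  assumes "odd k"
  shows "\<i> ^ k = of_int (jac4 (int k)) * \<i>"
proof -
  have "k mod 4 = 1 \<or> k mod 4 = 3"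
    using assms by presburger
  moreover have "int k mod 4 = int (k mod 4)"
    by (simp add: zmod_int)
  moreover have "\<i> ^ k = \<i> ^ (k mod 4)"
    by (rule root_of_unity_power_mod[symmetric]) simp
  ultimately show ?thesis
    by (auto simp: jac4_def numeral_3_eq_3)
qed

lemma zeta_8_square: "\<zeta> 8 ^ 2 = \<i>"
  using zeta_power_div[of 8 4] by (simp add: zeta_4)

lemma zeta_8_power_4: "\<zeta> 8 ^ 4 = - 1"
  using power_mult[of "\<zeta> 8" 2 2] by (simp add: zeta_8_square)

lemma zeta_8_sum_square: "(\<zeta> 8 + \<zeta> 8 ^ 7) ^ 2 = 2"
proof -
  have "(\<zeta> 8 + \<zeta> 8 ^ 7) ^ 2 = \<zeta> 8 ^ 2 + 2 * \<zeta> 8 ^ 8 + \<zeta> 8 ^ 8 * \<zeta> 8 ^ 4 * \<zeta> 8 ^ 2"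
    by (simp add: power2_eq_square eval_nat_numeral algebra_simps)
  thus ?thesis by (simp add: zeta_8_square zeta_8_power_4)
qed

lemma zeta_8_sum_odd:
  assumes "odd k"
  shows "\<zeta> 8 ^ k + \<zeta> 8 ^ (7 * k) = of_int (chi8 (int k)) * (\<zeta> 8 + \<zeta> 8 ^ 7)"
proof -
  have power_mod_8: "\<zeta> 8 ^ j = \<zeta> 8 ^ (j mod 8)" for j
    by (rule root_of_unity_power_mod[symmetric]) simp
  have "\<zeta> 8 ^ 5 = - \<zeta> 8" "\<zeta> 8 ^ 7 = - (\<zeta> 8 ^ 3)"
    using power_add[of "\<zeta> 8" 4 1] power_add[of "\<zeta> 8" 4 3] by (simp_all add: zeta_8_power_4)
  moreover have "k mod 8 = 1 \<or> k mod 8 = 3 \<or> k mod 8 = 5 \<or> k mod 8 = 7"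
    using assms by presburger
  moreover have "int k mod 8 = int (k mod 8)"
    by (simp add: zmod_int)
  moreover have "7 * k mod 8 = 7 * (k mod 8) mod 8"
    by (simp add: mod_mult_right_eq)
  ultimately show ?thesis
    by (subst power_mod_8[of k], subst power_mod_8[of "7 * k"]) (auto simp: chi8_def)
qed

definition sqrt_Delta :: "nat \<Rightarrow> nat \<Rightarrow> nat set \<Rightarrow> complex" where
  "sqrt_Delta w0 w S = (\<zeta> 8 + \<zeta> 8 ^ 7) ^ w0 * \<zeta> 4 ^ w * (\<Prod>p\<in>S. gauss_sum p (\<zeta> p))"

definition Delta_character :: "nat \<Rightarrow> nat \<Rightarrow> nat set \<Rightarrow> nat \<Rightarrow> int" where
  "Delta_character w0 w S k =
    chi8 (int k) ^ w0 * jac4 (int k) ^ w * (\<Prod>p\<in>S. Legendre (int k) (int p))"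

locale Delta_parameters =
  fixes n w0 w :: nat and S :: "nat set"
  assumes n_pos: "n > 0"
    and S_subset: "S \<subseteq> {p. prime p \<and> odd p \<and> p dvd n}"
    and w0_le_1: "w0 \<le> 1"
    and eight_dvd: "w0 \<noteq> 0 \<Longrightarrow> 8 dvd n"
    and four_dvd: "w \<noteq> 0 \<Longrightarrow> 4 dvd n"
begin

lemma S_prime: "p \<in> S \<Longrightarrow> prime p"
  and S_dvd: "p \<in> S \<Longrightarrow> p dvd n"
  using S_subset by auto

lemma S_gt_2: "p \<in> S \<Longrightarrow> 2 < p"
  using S_subset prime_gt_1_nat[of p] by (cases "p = 2") auto

lemma squarefree_Delta: "squarefree (Delta w0 w S)"
proof -
  have pstar_cases: "pstar p = int p \<or> pstar p = - int p" for p
    by (simp add: pstar_def minus_one_power_iff)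
  have "squarefree (2 ^ w0 * (\<Prod>p\<in>S. pstar p))"
  proof (rule squarefree_mult_coprime)
    show "coprime (2 ^ w0) (\<Prod>p\<in>S. pstar p)"
    proof (rule prod_coprime_right)
      fix p assume "p \<in> S"
      hence "coprime 2 (int p)" using S_subset by auto
      thus "coprime (2 ^ w0) (pstar p)" using pstar_cases[of p] by auto
    qed
    show "squarefree (2 ^ w0 :: int)"
      using w0_le_1 squarefree_prime[of "2::int"] by (cases w0) auto
    show "squarefree (\<Prod>p\<in>S. pstar p)"
    proof (rule squarefree_prod_coprime)
      fix p q assume "p \<in> S" "q \<in> S" "p \<noteq> q"
      hence "coprime (int p) (int q)" by (simp add: primes_coprime S_prime)
      thus "coprime (pstar p) (pstar q)" using pstar_cases[of p] pstar_cases[of q] by auto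
    next
      fix p assume "p \<in> S"
      hence "squarefree (int p)" by (simp add: squarefree_prime S_prime)
      thus "squarefree (pstar p)" using pstar_cases[of p] by auto
    qed
  qed
  thus ?thesis
    by (cases "even w") (simp_all add: Delta_def)
qed

lemma sqrt_Delta_square: "sqrt_Delta w0 w S ^ 2 = of_int (Delta w0 w S)"
proof -
  have "(\<Prod>p\<in>S. gauss_sum p (\<zeta> p)) ^ 2 = (\<Prod>p\<in>S. of_int (pstar p))"
    unfolding prod_power_distrib
    by (intro prod.cong refl gauss_sum_square S_prime S_gt_2)
  moreover have "(x ^ m) ^ 2 = (x ^ 2) ^ m" for x :: complex and m
    by (simp add: mult.commute flip: power_mult)
  ultimately show ?thesis
    by (simp add: sqrt_Delta_def Delta_def power_mult_distrib zeta_8_sum_square zeta_4)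
qed

lemma zeta_power_divisor:
  assumes "d dvd n"
  shows "\<zeta> d ^ j \<in> cyclotomic_integers n"
    and "coprime k n \<Longrightarrow> galois n k (\<zeta> d ^ j) = \<zeta> d ^ (j * k)"
proof -
  have zeta_d: "\<zeta> d ^ i = \<zeta> n ^ (n div d * i)" for i
    by (simp add: power_mult zeta_power_div[OF n_pos assms])
  show "\<zeta> d ^ j \<in> cyclotomic_integers n"
    by (simp add: zeta_d)
  show "galois n k (\<zeta> d ^ j) = \<zeta> d ^ (j * k)" if "coprime k n"
    by (simp add: zeta_d galois_zeta_power[OF n_pos that] mult_ac)
qed

lemma zeta_8_sum_conjugates:
  assumes "w0 \<noteq> 0"
  shows "\<zeta> 8 + \<zeta> 8 ^ 7 \<in> cyclotomic_integers n"
    and "coprime k n \<Longrightarrow> galois n k (\<zeta> 8 + \<zeta> 8 ^ 7) = of_int (chi8 k) * (\<zeta> 8 + \<zeta> 8 ^ 7)"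
proof -
  note eight_dvd_n = eight_dvd[OF assms]
  note powers_cyclotomic =
    zeta_power_divisor(1)[OF eight_dvd_n, of 1] zeta_power_divisor(1)[OF eight_dvd_n, of 7]
  show "\<zeta> 8 + \<zeta> 8 ^ 7 \<in> cyclotomic_integers n"
    using powers_cyclotomic by (simp add: cyclotomic_integers_add)
  assume coprime_k: "coprime k n"
  have "odd k"
    using coprime_divisors[OF dvd_refl dvd_trans[OF _ eight_dvd_n] coprime_k, of 2] by simp
  have "galois n k (\<zeta> 8 + \<zeta> 8 ^ 7) = \<zeta> 8 ^ k + \<zeta> 8 ^ (7 * k)"
    using powers_cyclotomic zeta_power_divisor(2)[OF eight_dvd_n coprime_k, of 1]
      zeta_power_divisor(2)[OF eight_dvd_n coprime_k, of 7]
    by (simp add: galois_add[OF n_pos coprime_k])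
  thus "galois n k (\<zeta> 8 + \<zeta> 8 ^ 7) = of_int (chi8 k) * (\<zeta> 8 + \<zeta> 8 ^ 7)"
    by (simp add: zeta_8_sum_odd[OF \<open>odd k\<close>])
qed

lemma zeta_4_conjugates:
  assumes "w \<noteq> 0"
  shows "\<zeta> 4 \<in> cyclotomic_integers n"
    and "coprime k n \<Longrightarrow> galois n k (\<zeta> 4) = of_int (jac4 k) * \<zeta> 4"
proof -
  note four_dvd_n = four_dvd[OF assms]
  show "\<zeta> 4 \<in> cyclotomic_integers n"
    using zeta_power_divisor(1)[OF four_dvd_n, of 1] by simp
  assume coprime_k: "coprime k n"
  have "odd k"
    using coprime_divisors[OF dvd_refl dvd_trans[OF _ four_dvd_n] coprime_k, of 2] by simp
  thus "galois n k (\<zeta> 4) = of_int (jac4 k) * \<zeta> 4"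
    using zeta_power_divisor(2)[OF four_dvd_n coprime_k, of 1] by (simp add: zeta_4 ii_power_odd)
qed

lemma gauss_sum_conjugates:
  assumes p_in_S: "p \<in> S"
  shows "gauss_sum p (\<zeta> p) \<in> cyclotomic_integers n"
    and "coprime k n \<Longrightarrow>
      galois n k (gauss_sum p (\<zeta> p)) = of_int (Legendre k p) * gauss_sum p (\<zeta> p)"
proof -
  have terms_cyclotomic: "of_int (Legendre j p) * \<zeta> p ^ l \<in> cyclotomic_integers n" for j l
    by (intro cyclotomic_integers_mult of_int_in_cyclotomic_integers zeta_power_divisor
        S_dvd p_in_S)
  show "gauss_sum p (\<zeta> p) \<in> cyclotomic_integers n"
    unfolding gauss_sum_def by (intro cyclotomic_integers_sum terms_cyclotomic)
  assume coprime_k: "coprime k n"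
  have "galois n k (gauss_sum p (\<zeta> p)) = gauss_sum p (\<zeta> p ^ k)"
    unfolding gauss_sum_def using n_pos coprime_k p_in_S terms_cyclotomic
    by (simp add: galois_sum galois_mult zeta_power_divisor S_dvd mult.commute flip: power_mult)
  also have "\<dots> = of_int (Legendre k p) * gauss_sum p (\<zeta> p)"
    using S_gt_2[OF p_in_S] by (intro gauss_sum_power S_prime p_in_S) auto
  finally show "galois n k (gauss_sum p (\<zeta> p)) = of_int (Legendre k p) * gauss_sum p (\<zeta> p)" .
qed

lemma sqrt_Delta_conjugates:
  shows "sqrt_Delta w0 w S \<in> cyclotomic_integers n"
    and "coprime k n \<Longrightarrow>
      galois n k (sqrt_Delta w0 w S) = of_int (Delta_character w0 w S k) * sqrt_Delta w0 w S"
proof -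
  have one_cyclotomic: "1 \<in> cyclotomic_integers n"
    using of_int_in_cyclotomic_integers[of 1] by simp
  have zeta_8_factor: "(\<zeta> 8 + \<zeta> 8 ^ 7) ^ w0 \<in> cyclotomic_integers n"
    using one_cyclotomic
    by (cases "w0 = 0") (simp_all add: cyclotomic_integers_power zeta_8_sum_conjugates)
  have zeta_4_factor: "\<zeta> 4 ^ w \<in> cyclotomic_integers n"
    using one_cyclotomic
    by (cases "w = 0") (simp_all add: cyclotomic_integers_power zeta_4_conjugates)
  have gauss_factor: "(\<Prod>p\<in>S. gauss_sum p (\<zeta> p)) \<in> cyclotomic_integers n"
    by (intro cyclotomic_integers_prod gauss_sum_conjugates)
  show "sqrt_Delta w0 w S \<in> cyclotomic_integers n"
    unfolding sqrt_Delta_def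
    by (intro cyclotomic_integers_mult zeta_8_factor zeta_4_factor gauss_factor)
  assume coprime_k: "coprime k n"
  have one_fixed: "galois n k 1 = 1"
    using galois_of_int[OF n_pos coprime_k, of 1] by simp
  have "galois n k ((\<zeta> 8 + \<zeta> 8 ^ 7) ^ w0) = (of_int (chi8 k) * (\<zeta> 8 + \<zeta> 8 ^ 7)) ^ w0"
    using n_pos coprime_k
    by (cases "w0 = 0") (simp_all add: galois_power zeta_8_sum_conjugates one_fixed)
  moreover have "galois n k (\<zeta> 4 ^ w) = (of_int (jac4 k) * \<zeta> 4) ^ w"
    using n_pos coprime_k
    by (cases "w = 0") (simp_all add: galois_power zeta_4_conjugates one_fixed)
  moreover have "galois n k (\<Prod>p\<in>S. gauss_sum p (\<zeta> p))
      = (\<Prod>p\<in>S. of_int (Legendre k p) * gauss_sum p (\<zeta> p))"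
    using n_pos coprime_k by (simp add: galois_prod gauss_sum_conjugates)
  ultimately show "galois n k (sqrt_Delta w0 w S)
      = of_int (Delta_character w0 w S k) * sqrt_Delta w0 w S"
    using n_pos coprime_k zeta_8_factor zeta_4_factor gauss_factor
    by (simp add: sqrt_Delta_def Delta_character_def galois_mult cyclotomic_integers_mult
        power_mult_distrib prod.distrib mult_ac)
qed

lemma csqrt_Delta_cases:
  "csqrt (of_int (Delta w0 w S)) = sqrt_Delta w0 w S \<or>
   csqrt (of_int (Delta w0 w S)) = - sqrt_Delta w0 w S"
proof -
  have "csqrt (of_int (Delta w0 w S)) ^ 2 = sqrt_Delta w0 w S ^ 2"
    by (simp only: sqrt_Delta_square power2_csqrt)
  thus ?thesis by (simp only: power2_eq_iff)
qed

sublocale quadratic_cyclotomic n "Delta w0 w S"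
proof
  show "csqrt (of_int (Delta w0 w S)) \<in> cyclotomic_integers n"
    using csqrt_Delta_cases sqrt_Delta_conjugates(1) cyclotomic_integers_uminus by metis
qed (fact n_pos squarefree_Delta)+

lemma sign_eq_Delta_character:
  assumes coprime_k: "coprime k n"
  shows "quadratic_sign k = Delta_character w0 w S k"
proof (rule sign_eqI[OF coprime_k])
  show "galois n k sqrt_D = of_int (Delta_character w0 w S k) * sqrt_D"
    using csqrt_Delta_cases
    by (elim disjE)
       (simp_all only: galois_uminus[OF n_pos coprime_k] sqrt_Delta_conjugates coprime_k
          mult_minus_right)
qed

lemma H_Delta_eq_sign_kernel: "H_Delta n w0 w S = sign_kernel"
  by (auto simp: H_Delta_def Delta_character_def units_mod_iff sign_eq_Delta_character)

end

section \<open>Multiples in finite abelian groups\<close>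

lemma gmul_0 [simp]: "gmul 0 g = 0"
  by (simp add: gmul_def)

lemma gmul_Suc [simp]: "gmul (Suc k) g = gmul k g + g"
  by (simp add: gmul_def)

lemma gmul_add: "gmul (k + l) g = gmul k g + gmul l g"
  by (induction l) (simp_all add: add.assoc)

lemma gmul_mult: "gmul (k * l) g = gmul k (gmul l g)"
  by (induction k) (simp_all add: gmul_add add.commute)

lemma gmul_commute: "gmul k (gmul l g) = gmul l (gmul k g)"
  by (simp add: mult.commute flip: gmul_mult)

lemma sum_const_eq_gmul_card: "finite A \<Longrightarrow> (\<Sum>x\<in>A. g) = gmul (card A) g"
  by (induction rule: finite_induct) (simp_all add: add.commute)

lemma gmul_CARD: "gmul CARD('a) g = (0 :: 'a::{ab_group_add,finite})"
proof -
  have "(\<Sum>x\<in>UNIV. x) = (\<Sum>x\<in>UNIV. x + g)"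
    by (rule sum.reindex_bij_betw[symmetric]) (auto simp: bij_plus_right)
  also have "\<dots> = (\<Sum>x\<in>UNIV. x) + gmul CARD('a) g"
    by (simp add: sum.distrib sum_const_eq_gmul_card)
  finally show ?thesis by simp
qed

lemma group_exponent_pos: "group_exponent TYPE('a::{ab_group_add,finite}) > 0"
  and gmul_group_exponent: "gmul (group_exponent TYPE('a)) (g::'a) = 0"
proof -
  have "0 < CARD('a) \<and> (\<forall>g::'a. gmul CARD('a) g = 0)"
    by (simp add: gmul_CARD)
  from LeastI[of "\<lambda>n. 0 < n \<and> (\<forall>g::'a. gmul n g = 0)", OF this]
  show "group_exponent TYPE('a) > 0" "gmul (group_exponent TYPE('a)) g = 0"
    unfolding group_exponent_def by blast+
qed

lemma gmul_mod:
  assumes "\<And>g::'a::ab_group_add. gmul n g = 0"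
  shows "gmul (k mod n) g = gmul k (g::'a)"
proof -
  have "gmul k g = gmul (n * (k div n) + k mod n) g"
    by simp
  also have "\<dots> = gmul (k mod n) g"
    by (simp only: gmul_add gmul_mult assms add_0_left)
  finally show ?thesis by simp
qed

lemma bij_gmul:
  assumes annihilates: "\<And>g::'a::ab_group_add. gmul n g = 0" and coprime_k: "coprime k n"
  shows "bij (gmul k :: 'a \<Rightarrow> 'a)"
proof -
  obtain l where "[k * l = 1] (mod n)"
    using cong_solve_coprime_nat[OF coprime_k] by auto
  hence "gmul (k * l) g = g" for g :: 'a
    using gmul_mod[OF annihilates, of "k * l" g] gmul_mod[OF annihilates, of 1 g]
    by (simp add: cong_def)
  hence "gmul k (gmul l g) = g" "gmul l (gmul k g) = g" for g :: 'a
    by (simp_all add: gmul_mult gmul_commute[of l])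
  thus ?thesis
    by (intro o_bij[of "gmul l"]) auto
qed

lemma gmul_minus_one:
  assumes "gmul n g = 0" "n > 0"
  shows "gmul (n - 1) g = - (g::'a::ab_group_add)"
  using assms gmul_Suc[of "n - 1" g] by (simp add: eq_neg_iff_add_eq_0)

section \<open>Characters of finite abelian groups\<close>

definition is_character :: "('a::ab_group_add \<Rightarrow> complex) \<Rightarrow> bool" where
  "is_character \<psi> \<longleftrightarrow> \<psi> 0 = 1 \<and> (\<forall>x y. \<psi> (x + y) = \<psi> x * \<psi> y)"

lemma character_zero: "is_character \<psi> \<Longrightarrow> \<psi> 0 = 1"
  and character_add: "is_character \<psi> \<Longrightarrow> \<psi> (x + y) = \<psi> x * \<psi> y"
  by (simp_all add: is_character_def)

lemma character_gmul: "is_character \<psi> \<Longrightarrow> \<psi> (gmul k g) = \<psi> g ^ k"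
  by (induction k) (simp_all add: character_zero character_add mult.commute)

definition pairing :: "('a::finite \<Rightarrow> complex) \<Rightarrow> ('a \<Rightarrow> complex) \<Rightarrow> complex" where
  "pairing f v = (\<Sum>g\<in>UNIV. f g * v g)"

definition translation_eigenfunction :: "'a::ab_group_add \<Rightarrow> ('a \<Rightarrow> complex) \<Rightarrow> bool" where
  "translation_eigenfunction b v \<longleftrightarrow> (\<exists>z. \<forall>x. v (x + b) = z * v x)"

lemma joint_eigenfunction_eq_multiple_of_character:
  assumes "\<And>b. translation_eigenfunction b v"
  obtains \<psi> c where "is_character \<psi>" "v = (\<lambda>g. c * \<psi> g)"
proof (cases "v 0 = 0")
  case True
  have "v g = 0" for g
    using assms[of g] True unfolding translation_eigenfunction_def
    by (metis add_0 mult_zero_right)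
  moreover have "is_character (\<lambda>_. 1)"
    by (simp add: is_character_def)
  ultimately show ?thesis
    using that[of "\<lambda>_. 1" 0] by auto
next
  case False
  obtain z where eigenvalues: "\<And>x b. v (x + b) = z b * v x"
    using assms unfolding translation_eigenfunction_def by metis
  have z_eq: "z g = v g / v 0" for g
    using eigenvalues[of 0 g] False by simp
  have "is_character (\<lambda>g. v g / v 0)"
    using False by (simp add: is_character_def eigenvalues z_eq)
  thus ?thesis
    using that[of "\<lambda>g. v g / v 0" "v 0"] False by simp
qed

definition eigencomponent :: "nat \<Rightarrow> 'a::ab_group_add \<Rightarrow> nat \<Rightarrow> ('a \<Rightarrow> complex) \<Rightarrow> 'a \<Rightarrow> complex" where
  "eigencomponent n b t v x = (\<Sum>j<n. inverse (\<zeta> n) ^ (t * j) * v (x + gmul j b))"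

lemma sum_eigencomponents:
  assumes n_pos: "n > 0"
  shows "(\<Sum>t<n. eigencomponent n b t v x) = of_nat n * v x"
proof -
  have power_sum: "(\<Sum>t<n. inverse (\<zeta> n) ^ (t * j)) = (if j = 0 then of_nat n else 0)"
    if "j < n" for j
  proof -
    have "(inverse (\<zeta> n) ^ j) ^ n = 1"
      using n_pos by (simp add: power_inverse)
    moreover have "inverse (\<zeta> n) ^ j = 1 \<longleftrightarrow> j = 0"
      using n_pos that by (auto simp: power_inverse zeta_power_eq_1_iff dest: dvd_imp_le)
    ultimately show ?thesis
      using sum_powers_root_of_unity[of "inverse (\<zeta> n) ^ j" n]
      by (simp add: mult.commute flip: power_mult)
  qed
  have "(\<Sum>t<n. eigencomponent n b t v x)
      = (\<Sum>j<n. (\<Sum>t<n. inverse (\<zeta> n) ^ (t * j)) * v (x + gmul j b))"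
    unfolding eigencomponent_def sum_distrib_right by (rule sum.swap)
  also have "\<dots> = (\<Sum>j<n. if j = 0 then of_nat n * v x else 0)"
    by (intro sum.cong refl) (simp add: power_sum)
  finally show ?thesis using n_pos by simp
qed

lemma eigencomponent_eigenfunction:
  assumes n_pos: "n > 0" and annihilates: "gmul n b = 0"
  shows "translation_eigenfunction b (eigencomponent n b t v)"
proof -
  have "eigencomponent n b t v (x + b) = \<zeta> n ^ t * eigencomponent n b t v x" for x
  proof -
    define h where "h j = inverse (\<zeta> n) ^ (t * j) * v (x + gmul j b)" for j
    have "\<zeta> n \<noteq> 0"
      by (simp add: root_of_unity_def)
    hence shift: "inverse (\<zeta> n) ^ (t * j) * v (x + b + gmul j b) = \<zeta> n ^ t * h (Suc j)" for j
      by (simp add: h_def power_add power_inverse add_ac)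
    have "h n = h 0"
      using n_pos by (simp add: h_def annihilates power_inverse zeta_power_eq_1_iff)
    hence "(\<Sum>j<n. h (Suc j)) = (\<Sum>j<n. h j)"
      using sum.lessThan_Suc_shift[of h n] sum.lessThan_Suc[of h n] by simp
    thus ?thesis
      by (simp add: eigencomponent_def shift flip: sum_distrib_left) (simp add: h_def)
  qed
  thus ?thesis by (auto simp: translation_eigenfunction_def)
qed

lemma eigencomponent_preserves_eigenfunction:
  assumes "translation_eigenfunction c v"
  shows "translation_eigenfunction c (eigencomponent n b t v)"
proof -
  obtain z where "\<And>x. v (x + c) = z * v x"
    using assms by (auto simp: translation_eigenfunction_def)
  hence "v (x + c + gmul j b) = z * v (x + gmul j b)" for x j
    by (metis add.assoc add.commute)
  hence "eigencomponent n b t v (x + c) = z * eigencomponent n b t v x" for x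
    by (simp add: eigencomponent_def sum_distrib_left mult_ac)
  thus ?thesis by (auto simp: translation_eigenfunction_def)
qed

text \<open>Splitting \<open>v\<close> into eigenfunctions of the translations by the elements of \<open>B\<close>, one after the
  other, leaves only joint eigenfunctions of all translations, the multiples of characters.\<close>
lemma pairing_eq_0_if_characters_annihilate:
  fixes f v :: "'a::{ab_group_add,finite} \<Rightarrow> complex"
  assumes annihilated: "\<And>\<psi>. is_character \<psi> \<Longrightarrow> pairing f \<psi> = 0"
    and finite_B: "finite B" and eigen_outside_B: "\<And>b. b \<notin> B \<Longrightarrow> translation_eigenfunction b v"
  shows "pairing f v = 0"
  using finite_B eigen_outside_B
proof (induction B arbitrary: v)
  case empty
  then obtain \<psi> c where "is_character \<psi>" "v = (\<lambda>g. c * \<psi> g)"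
    using joint_eigenfunction_eq_multiple_of_character by blast
  thus ?case
    using annihilated by (simp add: pairing_def mult.left_commute[of _ c] flip: sum_distrib_left)
next
  case (insert b B)
  define n where "n = group_exponent TYPE('a)"
  have n_pos: "n > 0" and n_annihilates: "gmul n b = 0"
    unfolding n_def by (rule group_exponent_pos gmul_group_exponent)+
  have "pairing f (eigencomponent n b t v) = 0" for t
  proof (rule insert.IH)
    fix c assume "c \<notin> B"
    thus "translation_eigenfunction c (eigencomponent n b t v)"
      using insert.prems[of c] eigencomponent_preserves_eigenfunction
        eigencomponent_eigenfunction[OF n_pos n_annihilates] by (cases "c = b") auto
  qed
  hence "(\<Sum>t<n. pairing f (eigencomponent n b t v)) = 0"
    by simp
  also have "(\<Sum>t<n. pairing f (eigencomponent n b t v))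
      = (\<Sum>g\<in>UNIV. f g * (\<Sum>t<n. eigencomponent n b t v g))"
    unfolding pairing_def sum_distrib_left by (rule sum.swap)
  also have "\<dots> = of_nat n * pairing f v"
    by (simp add: sum_eigencomponents[OF n_pos] pairing_def sum_distrib_left mult_ac)
  finally show ?case using n_pos by simp
qed

theorem characters_separate_functions:
  fixes f f' :: "'a::{ab_group_add,finite} \<Rightarrow> complex"
  shows "(\<forall>\<psi>. is_character \<psi> \<longrightarrow> pairing f \<psi> = pairing f' \<psi>) \<longleftrightarrow> f = f'"
proof
  assume pairings_eq: "\<forall>\<psi>. is_character \<psi> \<longrightarrow> pairing f \<psi> = pairing f' \<psi>"
  have "pairing (\<lambda>g. f g - f' g) (\<lambda>h. of_bool (h = g)) = 0" for g
    by (rule pairing_eq_0_if_characters_annihilate[of _ UNIV])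
       (use pairings_eq in \<open>auto simp: pairing_def left_diff_distrib sum_subtractf\<close>)
  thus "f = f'" by (simp add: pairing_def fun_eq_iff)
qed simp

section \<open>Eigenvalues of group matrices\<close>

definition group_matrix ::
    "('a::{ab_group_add,finite} \<Rightarrow> complex) \<Rightarrow> ((complex, 'a) vec, 'a) vec" where
  "group_matrix f = (\<chi> u v. f (v - u))"

lemma group_matrix_mult_vec: "(group_matrix f *v x) $ u = (\<Sum>g\<in>UNIV. f g * x $ (u + g))"
proof -
  have "(group_matrix f *v x) $ u = (\<Sum>v\<in>UNIV. f (v - u) * x $ v)"
    by (simp add: group_matrix_def matrix_vector_mult_def)
  also have "\<dots> = (\<Sum>g\<in>UNIV. f (u + g - u) * x $ (u + g))"
    by (rule sum.reindex_bij_betw[symmetric]) (rule bij_plus)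
  finally show ?thesis by simp
qed

lemma sum_group_matrix_mult_character:
  assumes character: "is_character \<psi>"
  shows "(\<Sum>u\<in>UNIV. (group_matrix f *v x) $ u * \<psi> (- u))
    = pairing f \<psi> * (\<Sum>u\<in>UNIV. x $ u * \<psi> (- u))"
proof -
  have shift: "(\<Sum>u\<in>UNIV. x $ (u + g) * \<psi> (- u)) = \<psi> g * (\<Sum>u\<in>UNIV. x $ u * \<psi> (- u))" for g
  proof -
    have "x $ (u + g) * \<psi> (- u) = \<psi> g * (x $ (u + g) * \<psi> (- (u + g)))" for u
      using character_add[OF character, of g "- (u + g)"] by simp
    hence "(\<Sum>u\<in>UNIV. x $ (u + g) * \<psi> (- u)) = \<psi> g * (\<Sum>u\<in>UNIV. x $ (u + g) * \<psi> (- (u + g)))"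
      unfolding sum_distrib_left by (intro sum.cong refl)
    also have "(\<Sum>u\<in>UNIV. x $ (u + g) * \<psi> (- (u + g))) = (\<Sum>u\<in>UNIV. x $ u * \<psi> (- u))"
      by (rule sum.reindex_bij_betw) (rule bij_plus_right)
    finally show ?thesis .
  qed
  have "(\<Sum>u\<in>UNIV. (group_matrix f *v x) $ u * \<psi> (- u))
      = (\<Sum>g\<in>UNIV. f g * (\<Sum>u\<in>UNIV. x $ (u + g) * \<psi> (- u)))"
    unfolding group_matrix_mult_vec sum_distrib_left sum_distrib_right
    by (subst sum.swap) (simp add: mult.assoc)
  thus ?thesis
    by (simp add: shift pairing_def sum_distrib_right mult.assoc)
qed

theorem eigenvalue_group_matrix_iff:
  "is_eigenvalue (group_matrix f) c \<longleftrightarrow> (\<exists>\<psi>. is_character \<psi> \<and> c = pairing f \<psi>)"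
proof
  assume "\<exists>\<psi>. is_character \<psi> \<and> c = pairing f \<psi>"
  then obtain \<psi> where character: "is_character \<psi>" and c_eq: "c = pairing f \<psi>"
    by blast
  have "group_matrix f *v (\<chi> g. \<psi> g) = c *s (\<chi> g. \<psi> g)"
    by (simp add: vec_eq_iff group_matrix_mult_vec character_add[OF character] c_eq pairing_def
        sum_distrib_left sum_distrib_right mult_ac)
  moreover have "(\<chi> g. \<psi> g) \<noteq> 0"
    using character_zero[OF character] by (auto simp: vec_eq_iff intro!: exI[of _ 0])
  ultimately show "is_eigenvalue (group_matrix f) c"
    unfolding is_eigenvalue_def by blast
next
  assume "is_eigenvalue (group_matrix f) c"
  then obtain x where x_nonzero: "x \<noteq> 0" and eigenvector: "group_matrix f *v x = c *s x"
    unfolding is_eigenvalue_def by blast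
  show "\<exists>\<psi>. is_character \<psi> \<and> c = pairing f \<psi>"
  proof (rule ccontr)
    assume no_character: "\<not> ?thesis"
    have "pairing (\<lambda>u. x $ (- u)) \<psi> = 0" if character: "is_character \<psi>" for \<psi>
    proof -
      have "c * (\<Sum>u\<in>UNIV. x $ u * \<psi> (- u)) = pairing f \<psi> * (\<Sum>u\<in>UNIV. x $ u * \<psi> (- u))"
        using sum_group_matrix_mult_character[OF character, of f x]
        by (simp add: eigenvector sum_distrib_left mult_ac)
      hence "(\<Sum>u\<in>UNIV. x $ u * \<psi> (- u)) = 0"
        using no_character character by auto
      thus ?thesis
        using sum.reindex_bij_betw[OF bij_uminus, of "\<lambda>u. x $ u * \<psi> (- u)"]
        by (simp add: pairing_def)
    qed
    hence "(\<lambda>u. x $ (- u)) = (\<lambda>_. 0)"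
      by (intro characters_separate_functions[THEN iffD1]) (simp add: pairing_def)
    hence "x $ (- (- u)) = 0" for u
      by (rule fun_cong)
    thus False using x_nonzero by (simp add: vec_eq_iff)
  qed
qed

section \<open>Galois conjugates of character sums\<close>

lemma character_value_galois:
  fixes \<psi> :: "'a::ab_group_add \<Rightarrow> complex"
  assumes n_pos: "n > 0" and annihilates: "gmul n g = 0" and character: "is_character \<psi>"
  shows "\<psi> g \<in> cyclotomic_integers n"
    and "coprime k n \<Longrightarrow> galois n k (\<psi> g) = \<psi> (gmul k g)"
proof -
  have "\<psi> g ^ n = 1"
    using character_gmul[OF character, of n g]
    by (simp add: annihilates character_zero[OF character])
  then obtain j where psi_g: "\<psi> g = \<zeta> n ^ j"
    by (rule eq_zeta_powerE[OF n_pos])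
  show "\<psi> g \<in> cyclotomic_integers n"
    by (simp add: psi_g)
  show "galois n k (\<psi> g) = \<psi> (gmul k g)" if "coprime k n"
    by (simp add: character_gmul[OF character] psi_g galois_zeta_power[OF n_pos that] power_mult)
qed

context
  fixes n :: nat and f :: "'a::{ab_group_add,finite} \<Rightarrow> int"
  assumes n_pos: "n > 0" and annihilates: "\<And>g::'a. gmul n g = 0"
begin

lemma pairing_in_cyclotomic_integers:
  "is_character \<psi> \<Longrightarrow> pairing (of_int \<circ> f) \<psi> \<in> cyclotomic_integers n"
  by (simp add: pairing_def cyclotomic_integers_sum cyclotomic_integers_mult
      character_value_galois[OF n_pos annihilates])

lemma galois_pairing:
  assumes character: "is_character \<psi>" and coprime_k: "coprime k n"
  shows "galois n k (pairing (of_int \<circ> f) \<psi>) = pairing (of_int \<circ> f \<circ> inv_into UNIV (gmul k)) \<psi>"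
proof -
  have bij_gmul_k: "bij (gmul k :: 'a \<Rightarrow> 'a)"
    by (rule bij_gmul[OF annihilates coprime_k])
  have "galois n k (pairing (of_int \<circ> f) \<psi>) = (\<Sum>g\<in>UNIV. of_int (f g) * \<psi> (gmul k g))"
    using character_value_galois[OF n_pos annihilates character]
    by (simp add: pairing_def coprime_k cyclotomic_integers_mult galois_sum[OF n_pos coprime_k]
        galois_mult[OF n_pos coprime_k] galois_of_int[OF n_pos coprime_k])
  also have "\<dots> = (\<Sum>g\<in>UNIV. of_int (f (inv_into UNIV (gmul k) (gmul k g))) * \<psi> (gmul k g))"
    using bij_gmul_k by (simp add: bij_is_inj)
  also have "\<dots> = pairing (of_int \<circ> f \<circ> inv_into UNIV (gmul k)) \<psi>"
    unfolding pairing_def comp_def by (rule sum.reindex_bij_betw[OF bij_gmul_k])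
  finally show ?thesis .
qed

theorem galois_pairing_eq_multiple_iff:
  assumes coprime_k: "coprime k n"
  shows "(\<forall>\<psi>. is_character \<psi> \<longrightarrow>
      galois n k (pairing (of_int \<circ> f) \<psi>) = of_int s * pairing (of_int \<circ> f) \<psi>)
    \<longleftrightarrow> (\<forall>g. f g = s * f (gmul k g))"
proof -
  have bij_gmul_k: "bij (gmul k :: 'a \<Rightarrow> 'a)"
    by (rule bij_gmul[OF annihilates coprime_k])
  have scaled_pairing: "of_int s * pairing (of_int \<circ> f) \<psi> = pairing (\<lambda>g. of_int (s * f g)) \<psi>"
    for \<psi>
    by (simp add: pairing_def sum_distrib_left mult.assoc)
  have "(\<forall>\<psi>. is_character \<psi> \<longrightarrow>
      galois n k (pairing (of_int \<circ> f) \<psi>) = of_int s * pairing (of_int \<circ> f) \<psi>)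
    \<longleftrightarrow> of_int \<circ> f \<circ> inv_into UNIV (gmul k) = (\<lambda>g. of_int (s * f g) :: complex)"
    by (simp only: galois_pairing[OF _ coprime_k] scaled_pairing characters_separate_functions
        cong: imp_cong)
  also have "\<dots> \<longleftrightarrow> (\<forall>h. f (inv_into UNIV (gmul k) h) = s * f h)"
    by (simp only: fun_eq_iff comp_def of_int_eq_iff)
  also have "\<dots> \<longleftrightarrow> (\<forall>g. f g = s * f (gmul k g))"
    using bij_gmul_k by (metis bij_inv_eq_iff)
  finally show ?thesis .
qed

end

section \<open>Signed Cayley graphs\<close>

definition signed_indicator :: "'a set \<Rightarrow> 'a set \<Rightarrow> 'a \<Rightarrow> int" where
  "signed_indicator C1 C2 g = of_bool (g \<in> C1) - of_bool (g \<in> C2)"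

lemma A_set_nth: "A_set C $ u $ v = of_bool (v - u \<in> C)"
  by (simp add: A_set_def A_elem_def of_bool_def)

lemma A_set_diff_eq_group_matrix:
  "A_set C1 - A_set C2 = group_matrix (of_int \<circ> signed_indicator C1 C2)"
  by (simp add: vec_eq_iff A_set_nth group_matrix_def signed_indicator_def)

lemma transpose_A_set: "transpose (A_set C) = A_set (uminus ` C)"
proof -
  have "v - u \<in> uminus ` C \<longleftrightarrow> u - v \<in> C" for u v
    using inj_image_mem_iff[of uminus "u - v" C] by simp
  thus ?thesis
    by (simp add: vec_eq_iff transpose_def A_set_nth)
qed

lemma transpose_diff: "transpose (A - B) = transpose A - transpose (B :: 'a::group_add^'n^'m)"
  by (simp add: vec_eq_iff transpose_def)

lemma union_of_classes_iff: "union_of_classes K C \<longleftrightarrow> (\<forall>k\<in>K. \<forall>h. gmul k h \<in> C \<longleftrightarrow> h \<in> C)"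
  unfolding union_of_classes_def equivH_def by blast

lemma eq_image_bij_iff:
  assumes "bij f"
  shows "B = f ` A \<longleftrightarrow> (\<forall>x. f x \<in> B \<longleftrightarrow> x \<in> A)"
proof -
  have "B = f ` A \<longleftrightarrow> f -` B = A"
    using assms by (metis bij_def inj_vimage_image_eq surj_image_vimage_eq)
  thus ?thesis by auto
qed

locale quadratic_cayley = quadratic_cyclotomic n D for n D +
  fixes C1 C2 :: "'a::{ab_group_add,finite} set"
  assumes annihilates: "gmul n (g::'a) = 0"
    and disjoint: "C1 \<inter> C2 = {}"
begin

abbreviation f :: "'a \<Rightarrow> int" where
  "f \<equiv> signed_indicator C1 C2"

abbreviation sign_equivariant :: bool where
  "sign_equivariant \<equiv> \<forall>k\<in>units_mod n. \<forall>g. f g = \<epsilon> k * f (gmul k g)"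

abbreviation swapped :: bool where
  "swapped \<equiv> union_of_classes H C1 \<and> (\<exists>k\<in>units_mod n - H. C2 = gmul k ` C1)"

lemma signed_indicator_eq_iff: "f g = f h \<longleftrightarrow> (g \<in> C1 \<longleftrightarrow> h \<in> C1) \<and> (g \<in> C2 \<longleftrightarrow> h \<in> C2)"
  using disjoint by (auto simp: signed_indicator_def of_bool_def)

lemma signed_indicator_eq_minus_iff:
  "f g = - f h \<longleftrightarrow> (g \<in> C1 \<longleftrightarrow> h \<in> C2) \<and> (g \<in> C2 \<longleftrightarrow> h \<in> C1)"
  using disjoint by (auto simp: signed_indicator_def of_bool_def)

lemma all_eigenvalues_iff:
  "(\<forall>c. is_eigenvalue (A_set C1 - A_set C2) c \<longrightarrow> P c) \<longleftrightarrow>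
    (\<forall>\<psi>. is_character \<psi> \<longrightarrow> P (pairing (of_int \<circ> f) \<psi>))"
  unfolding A_set_diff_eq_group_matrix eigenvalue_group_matrix_iff by blast

theorem eigenvalues_in_Q_sqrt_iff:
  "(\<forall>c. is_eigenvalue (A_set C1 - A_set C2) c \<longrightarrow> c \<in> Q_sqrt D) \<longleftrightarrow>
    union_of_classes H C1 \<and> union_of_classes H C2"
proof -
  have "(\<forall>c. is_eigenvalue (A_set C1 - A_set C2) c \<longrightarrow> c \<in> Q_sqrt D) \<longleftrightarrow>
      (\<forall>k\<in>H. \<forall>\<psi>. is_character \<psi> \<longrightarrow>
        galois n k (pairing (of_int \<circ> f) \<psi>) = of_int 1 * pairing (of_int \<circ> f) \<psi>)"
    unfolding all_eigenvalues_iff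
    by (simp add: in_Q_sqrt_iff_galois_fixed pairing_in_cyclotomic_integers[OF n_pos annihilates])
       blast
  also have "\<dots> \<longleftrightarrow> (\<forall>k\<in>H. \<forall>g. f g = 1 * f (gmul k g))"
    by (intro ball_cong refl galois_pairing_eq_multiple_iff n_pos annihilates)
       (simp add: units_mod_iff)
  also have "\<dots> \<longleftrightarrow> union_of_classes H C1 \<and> union_of_classes H C2"
    unfolding mult_1 signed_indicator_eq_iff union_of_classes_iff by blast
  finally show ?thesis .
qed

lemma eigenvalues_in_int_mult_sqrt_iff_equivariant:
  "(\<forall>c. is_eigenvalue (A_set C1 - A_set C2) c \<longrightarrow> c \<in> int_mult_sqrt D) \<longleftrightarrow> sign_equivariant"
proof -
  have "(\<forall>c. is_eigenvalue (A_set C1 - A_set C2) c \<longrightarrow> c \<in> int_mult_sqrt D) \<longleftrightarrow>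
      (\<forall>k\<in>units_mod n. \<forall>\<psi>. is_character \<psi> \<longrightarrow>
        galois n k (pairing (of_int \<circ> f) \<psi>) = of_int (\<epsilon> k) * pairing (of_int \<circ> f) \<psi>)"
    unfolding all_eigenvalues_iff
    by (simp add: in_int_mult_sqrt_iff_galois_twisted
        pairing_in_cyclotomic_integers[OF n_pos annihilates])
       blast
  also have "\<dots> \<longleftrightarrow> sign_equivariant"
    by (intro ball_cong refl galois_pairing_eq_multiple_iff n_pos annihilates)
       (simp add: units_mod_iff)
  finally show ?thesis .
qed

lemma union_of_sign_kernel_classesD:
  assumes "union_of_classes H C" "coprime l n" "\<epsilon> l = 1"
  shows "gmul l (g::'a) \<in> C \<longleftrightarrow> g \<in> C"
proof -
  have "l mod n \<in> H"
    using assms n_pos by (simp add: units_mod_iff coprime_mod_left_iff sign_mod)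
  thus ?thesis
    using assms(1) gmul_mod[OF annihilates, of l g] unfolding union_of_classes_iff by metis
qed

lemma gmul_exchanges_if_image:
  assumes C1_union: "union_of_classes H C1" and k_outside_H: "k \<in> units_mod n - H"
    and C2_eq: "C2 = gmul k ` C1"
  shows "gmul k g \<in> C2 \<longleftrightarrow> g \<in> C1" "gmul k g \<in> C1 \<longleftrightarrow> g \<in> C2"
proof -
  have coprime_k: "coprime k n" and sign_k: "\<epsilon> k = - 1"
    using k_outside_H sign_cases[of k] by (auto simp: units_mod_iff)
  have bij_gmul_k: "bij (gmul k :: 'a \<Rightarrow> 'a)"
    by (rule bij_gmul[OF annihilates coprime_k])
  show C2_iff: "gmul k g \<in> C2 \<longleftrightarrow> g \<in> C1" for g
    using C2_eq eq_image_bij_iff[OF bij_gmul_k] by blast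
  obtain g' where g_eq: "g = gmul k g'"
    using bij_gmul_k by (metis bij_pointE)
  have "gmul (k * k) g' \<in> C1 \<longleftrightarrow> g' \<in> C1"
    using coprime_k sign_k
    by (intro union_of_sign_kernel_classesD C1_union) (simp_all add: sign_mult)
  thus "gmul k g \<in> C1 \<longleftrightarrow> g \<in> C2"
    by (simp add: g_eq C2_iff gmul_mult)
qed

text \<open>The units of sign \<open>-1\<close> form a single coset of \<open>H\<close>, so that one of them exchanging \<open>C1\<close> and
  \<open>C2\<close> makes all of them do so.\<close>
lemma sign_equivariant_if_swapped:
  assumes swapped
  shows sign_equivariant
proof (intro ballI allI)
  fix l g assume "l \<in> units_mod n"
  hence coprime_l: "coprime l n"
    by (simp add: units_mod_iff)
  obtain k where k_outside_H: "k \<in> units_mod n - H" and C2_eq: "C2 = gmul k ` C1"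
    using assms by blast
  have C1_union: "union_of_classes H C1"
    using assms by blast
  note exchanges = gmul_exchanges_if_image[OF C1_union k_outside_H C2_eq]
  have kernel_C1: "gmul m x \<in> C1 \<longleftrightarrow> x \<in> C1" if "coprime m n" "\<epsilon> m = 1" for m x
    using union_of_sign_kernel_classesD[OF C1_union that] .
  have kernel_C2: "gmul m x \<in> C2 \<longleftrightarrow> x \<in> C2" if "coprime m n" "\<epsilon> m = 1" for m x
    using kernel_C1[OF that, of "gmul k x"] by (simp only: gmul_commute[of m] exchanges(2))
  show "f g = \<epsilon> l * f (gmul l g)"
  proof (cases "\<epsilon> l = 1")
    case True
    thus ?thesis
      using kernel_C1[OF coprime_l] kernel_C2[OF coprime_l] by (simp add: signed_indicator_eq_iff)
  next
    case False
    hence sign_l: "\<epsilon> l = - 1"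
      using sign_cases[of l] by blast
    have "coprime (k * l) n" "\<epsilon> (k * l) = 1"
      using k_outside_H coprime_l sign_l sign_cases[of k] by (auto simp: units_mod_iff sign_mult)
    hence "gmul l g \<in> C2 \<longleftrightarrow> g \<in> C1" "gmul l g \<in> C1 \<longleftrightarrow> g \<in> C2"
      using kernel_C1[of "k * l" g] kernel_C2[of "k * l" g] by (simp_all add: gmul_mult exchanges)
    hence "f g = - f (gmul l g)"
      by (simp add: signed_indicator_eq_minus_iff)
    thus ?thesis
      by (simp add: sign_l)
  qed
qed

lemma swapped_if_sign_equivariant:
  assumes equivariant: sign_equivariant and D_neq_1: "D \<noteq> 1"
  shows swapped
proof
  show "union_of_classes H C1"
    unfolding union_of_classes_iff
  proof (intro ballI allI)
    fix k g assume "k \<in> H"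
    hence "f g = f (gmul k g)"
      using equivariant[rule_format, of k g] by simp
    thus "gmul k g \<in> C1 \<longleftrightarrow> g \<in> C1"
      by (simp add: signed_indicator_eq_iff)
  qed
  obtain k where k_unit: "k \<in> units_mod n" and sign_k: "\<epsilon> k = - 1"
    using D_neq_1 D_eq_1_iff sign_cases by blast
  have "gmul k g \<in> C2 \<longleftrightarrow> g \<in> C1" for g
  proof -
    have "f g = - f (gmul k g)"
      using equivariant[rule_format, OF k_unit, of g] sign_k by simp
    thus ?thesis
      by (simp add: signed_indicator_eq_minus_iff)
  qed
  hence "C2 = gmul k ` C1"
    using k_unit
    by (subst eq_image_bij_iff[OF bij_gmul[OF annihilates]]) (auto simp: units_mod_iff)
  moreover have "k \<in> units_mod n - H"
    using k_unit sign_k by simp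
  ultimately show "\<exists>k\<in>units_mod n - H. C2 = gmul k ` C1"
    by blast
qed

lemma sign_equivariant_iff_unions:
  assumes "D = 1"
  shows "sign_equivariant \<longleftrightarrow>
    union_of_classes (units_mod n) C1 \<and> union_of_classes (units_mod n) C2"
proof -
  have "sign_equivariant \<longleftrightarrow> (\<forall>k\<in>units_mod n. \<forall>g. f g = f (gmul k g))"
    using assms D_eq_1_iff by simp
  thus ?thesis
    unfolding signed_indicator_eq_iff union_of_classes_iff by blast
qed

theorem eigenvalues_in_int_mult_sqrt_iff:
  "(\<forall>c. is_eigenvalue (A_set C1 - A_set C2) c \<longrightarrow> c \<in> int_mult_sqrt D) \<longleftrightarrow>
    (D = 1 \<and> union_of_classes (units_mod n) C1 \<and> union_of_classes (units_mod n) C2)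
    \<or> (D \<noteq> 1 \<and> swapped)"
  unfolding eigenvalues_in_int_mult_sqrt_iff_equivariant
  using sign_equivariant_iff_unions sign_equivariant_if_swapped swapped_if_sign_equivariant
  by argo

lemma swapped_imp_signed_indicator_uminus:
  assumes swapped
  shows "f g = sgn D * f (- g)"
proof -
  have "n - 1 \<in> units_mod n"
    using n_pos coprime_diff_one_left_nat[OF n_pos] by (simp add: units_mod_iff)
  hence "f g = \<epsilon> (n - 1) * f (gmul (n - 1) g)"
    using sign_equivariant_if_swapped[OF assms] by blast
  thus ?thesis
    by (simp only: sign_minus_one gmul_minus_one[OF annihilates n_pos])
qed

theorem swapped_imp_skew_symmetric:
  assumes swapped and "D < 0"
  shows "C2 = uminus ` C1" "C1 \<inter> uminus ` C1 = {}"
    "A_set C1 - A_set C2 = A_set C1 - transpose (A_set C1)"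
proof -
  have "f g = - f (- g)" for g
    using swapped_imp_signed_indicator_uminus[OF assms(1), of g] assms(2) by simp
  thus C2_eq: "C2 = uminus ` C1"
    unfolding eq_image_bij_iff[OF bij_uminus] signed_indicator_eq_minus_iff by blast
  show "C1 \<inter> uminus ` C1 = {}"
    using disjoint C2_eq by simp
  show "A_set C1 - A_set C2 = A_set C1 - transpose (A_set C1)"
    by (simp add: transpose_A_set C2_eq)
qed

theorem swapped_imp_symmetric:
  assumes swapped and "D > 0"
  shows "C1 = uminus ` C1" "C2 = uminus ` C2"
    "transpose (A_set C1 - A_set C2) = A_set C1 - A_set C2"
proof -
  have "f g = f (- g)" for g
    using swapped_imp_signed_indicator_uminus[OF assms(1), of g] assms(2) by simp
  thus uminus_invariant: "C1 = uminus ` C1" "C2 = uminus ` C2"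
    unfolding eq_image_bij_iff[OF bij_uminus] signed_indicator_eq_iff by blast+
  show "transpose (A_set C1 - A_set C2) = A_set C1 - A_set C2"
    by (simp add: transpose_diff transpose_A_set flip: uminus_invariant)
qed

end

theorem theorem8p1:
  fixes C1 C2 :: "'a::{ab_group_add,finite} set"
    and n1 :: nat and w0 w :: nat and S :: "nat set" and M :: "((complex, 'a) vec, 'a) vec"
  assumes n1_def: "n1 = group_exponent TYPE('a)"
    and S_sub: "S \<subseteq> {p. prime p \<and> odd p \<and> p dvd n1}"
    and w0_01: "w0 \<in> {0, 1}" and w_01: "w \<in> {0, 1}"
    and w0_m: "multiplicity (2::nat) n1 < 3 \<Longrightarrow> w0 = 0"
    and w_m: "multiplicity (2::nat) n1 < 2 \<Longrightarrow> w = 0"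
    and disj: "C1 \<inter> C2 = {}"
    and zero_notin: "0 \<notin> C1 \<union> C2"
    and M_def: "M = A_set C1 - A_set C2"
  shows
    "((\<forall>c. is_eigenvalue M c \<longrightarrow> c \<in> Q_sqrt (Delta w0 w S)) \<longleftrightarrow>
        union_of_classes (H_Delta n1 w0 w S) C1 \<and> union_of_classes (H_Delta n1 w0 w S) C2)
     \<and>
     ((\<forall>c. is_eigenvalue M c \<longrightarrow> c \<in> int_mult_sqrt (Delta w0 w S)) \<longleftrightarrow>
        (Delta w0 w S = 1 \<and> union_of_classes (H_Delta n1 0 0 {}) C1
                          \<and> union_of_classes (H_Delta n1 0 0 {}) C2)
        \<or> (Delta w0 w S \<noteq> 1 \<and> union_of_classes (H_Delta n1 w0 w S) C1
           \<and> (\<exists>k \<in> units_mod n1 - H_Delta n1 w0 w S. C2 = gmul k ` C1)))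
     \<and>
     ((Delta w0 w S \<noteq> 1 \<and> union_of_classes (H_Delta n1 w0 w S) C1
        \<and> (\<exists>k \<in> units_mod n1 - H_Delta n1 w0 w S. C2 = gmul k ` C1)) \<longrightarrow>
       (Delta w0 w S < 0 \<longrightarrow> C2 = uminus ` C1 \<and> C1 \<inter> uminus ` C1 = {}
          \<and> M = A_set C1 - transpose (A_set C1))
       \<and> (Delta w0 w S > 0 \<longrightarrow> C1 = uminus ` C1 \<and> C2 = uminus ` C2
          \<and> transpose M = M))"
proof -
  have n_pos: "n1 > 0" and annihilates: "gmul n1 (g::'a) = 0" for g
    unfolding n1_def by (rule group_exponent_pos gmul_group_exponent)+
  have "8 dvd n1" if "w0 \<noteq> 0"
    using w0_m that multiplicity_dvd'[of 3 2 n1] by (cases "multiplicity 2 n1 < 3") auto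
  moreover have "4 dvd n1" if "w \<noteq> 0"
    using w_m that multiplicity_dvd'[of 2 2 n1] by (cases "multiplicity 2 n1 < 2") auto
  ultimately interpret Delta_parameters n1 w0 w S
    using n_pos S_sub w0_01 by unfold_locales auto
  interpret quadratic_cayley n1 "Delta w0 w S" C1 C2
    using annihilates disj by unfold_locales auto
  have H_Delta_trivial: "H_Delta n1 0 0 {} = units_mod n1"
    by (simp add: H_Delta_def)
  show ?thesis
    unfolding H_Delta_trivial H_Delta_eq_sign_kernel M_def
    by (intro conjI impI eigenvalues_in_Q_sqrt_iff eigenvalues_in_int_mult_sqrt_iff
        swapped_imp_skew_symmetric swapped_imp_symmetric; elim conjE; assumption)
qed

end
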